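(* Let $M$ be an oriented hypersurface in the Minkowski space $\mathbb{E}^{n+1}_1$ and let $k$ be a fixed vector of $\mathbb{E}^{n+1}_1$, with tangential component $U$ along $M$. Consider a unit tangent vector field $e_1$ along $U$, where $U$ may be time-like, space-like or light-like. (If $U$ is light-like, $e_1$ is the light-like tangent vector field along $U$ for which $k=\phi(e_1-N)$ for a function $\phi$.) Then $M$ is a CPD hypersurface if and only if a curve $\alpha$ is a geodesic of $M$ whenever it is an integral curve of $e_1$.
   Context: $\mathbb{E}^{n+1}_1$ is $\mathbb{R}^{n+1}$ with the metric $\langle\cdot,\cdot\rangle=\sum_{i=1}^{n}dx_i^2-dx_{n+1}^2$ and Levi-Civita connection $\widetilde\nabla$. A nonzero vector $v$ is space-like, time-like or light-like if $\langle v,v\rangle$ is positive, negative or zero, respectively. The hypersurface $M$ is non-degenerate (its induced metric is Riemannian or Lorentzian), $N$ is its unit normal vector field ($\langle N,N\rangle=\pm1$), and its shape operator $S$ is defined by $\widetilde\nabla_XN=-S(X)$ for $X$ tangent to $M$. The fixed vector is decomposed along $M$ as $k=U+\langle N,N\rangle\langle k,N\rangle N$ with $U$ tangent to $M$. $M$ is called a CPD hypersurface (endowed with a canonical principal direction relative to $k$) if the tangential component $U$ of $k$ is a principal direction, i.e. $S(U)=k_1U$ for a smooth function $k_1$. *)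

theory Defs
  imports "HOL-Analysis.Analysis"
begin

section \<open>Minkowski space\<close>

text \<open>The first component of the pair collects the n space-like coordinates, the second one
  is the time-like coordinate with index n + 1; n is the cardinality of the index type.\<close>

type_synonym 'n minkowski = "(real ^ 'n) \<times> real"

definition mink :: "'n::finite minkowski \<Rightarrow> 'n minkowski \<Rightarrow> real" where
  "mink v w = (\<Sum>i\<in>UNIV. fst v $ i * fst w $ i) - snd v * snd w"

definition spacelike :: "'n::finite minkowski \<Rightarrow> bool" where
  "spacelike v \<longleftrightarrow> v \<noteq> 0 \<and> mink v v > 0"

definition timelike :: "'n::finite minkowski \<Rightarrow> bool" where
  "timelike v \<longleftrightarrow> v \<noteq> 0 \<and> mink v v < 0"

definition lightlike :: "'n::finite minkowski \<Rightarrow> bool" where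
  "lightlike v \<longleftrightarrow> v \<noteq> 0 \<and> mink v v = 0"


section \<open>Smooth maps on open subsets of Euclidean spaces\<close>

text \<open>In finite dimension, continuity of all directional derivatives of a differentiable map is
  continuity of its derivative, so for open \<open>S\<close> this is the usual class of k times
  continuously differentiable maps.\<close>

primrec Ck_on ::
  "nat \<Rightarrow> 'a::euclidean_space set \<Rightarrow> ('a \<Rightarrow> 'b::real_normed_vector) \<Rightarrow> bool" where
  "Ck_on 0 S f \<longleftrightarrow> continuous_on S f"
| "Ck_on (Suc k) S f \<longleftrightarrow>
     (\<forall>x\<in>S. f differentiable (at x)) \<and>
     (\<forall>v. Ck_on k S (\<lambda>x. frechet_derivative f (at x) v))"

definition smooth_on ::
  "'a::euclidean_space set \<Rightarrow> ('a \<Rightarrow> 'b::real_normed_vector) \<Rightarrow> bool" where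
  "smooth_on S f \<longleftrightarrow> (\<forall>k. Ck_on k S f)"


section \<open>Immersed hypersurfaces\<close>

text \<open>A hypersurface is a set \<open>M\<close> with its subspace topology together with an immersion
  \<open>x\<close> of \<open>M\<close> into Minkowski space; embedded hypersurfaces are the case where \<open>M\<close> is a subset
  of Minkowski space and \<open>x\<close> is the identity. The smooth structure is the one making \<open>x\<close> a
  smooth immersion. It is determined by \<open>x\<close> and the topology: two homeomorphic parametrizations
  whose compositions with \<open>x\<close> are smooth immersions are smoothly compatible, because an immersion
  locally has a smooth left inverse. Hence the parametrizations below form the maximal atlas.\<close>

definition local_param ::
  "'m::topological_space set \<Rightarrow> ('m \<Rightarrow> 'n::finite minkowski) \<Rightarrow>
   (real ^ 'n) set \<Rightarrow> (real ^ 'n \<Rightarrow> 'm) \<Rightarrow> bool" where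
  "local_param M x D \<psi> \<longleftrightarrow>
     open D \<and> openin (top_of_set M) (\<psi> ` D) \<and>
     homeomorphism D (\<psi> ` D) \<psi> (the_inv_into D \<psi>) \<and> inj_on \<psi> D \<and>
     smooth_on D (x \<circ> \<psi>) \<and>
     (\<forall>u\<in>D. inj (frechet_derivative (x \<circ> \<psi>) (at u)))"

definition immersed_hypersurface ::
  "'m::topological_space set \<Rightarrow> ('m \<Rightarrow> 'n::finite minkowski) \<Rightarrow> bool" where
  "immersed_hypersurface M x \<longleftrightarrow> (\<forall>p\<in>M. \<exists>D \<psi>. local_param M x D \<psi> \<and> p \<in> \<psi> ` D)"

definition smooth_map ::
  "'m::topological_space set \<Rightarrow> ('m \<Rightarrow> 'n::finite minkowski) \<Rightarrow>
   ('m \<Rightarrow> 'b::real_normed_vector) \<Rightarrow> bool" where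
  "smooth_map M x f \<longleftrightarrow> (\<forall>D \<psi>. local_param M x D \<psi> \<longrightarrow> smooth_on D (f \<circ> \<psi>))"

text \<open>Tangent vectors of \<open>M\<close> at \<open>p\<close> are identified with their images under the differential
  of \<open>x\<close>, i.e. with vectors of Minkowski space.\<close>

definition tangent_space ::
  "'m::topological_space set \<Rightarrow> ('m \<Rightarrow> 'n::finite minkowski) \<Rightarrow> 'm \<Rightarrow> 'n minkowski set" where
  "tangent_space M x p =
     {frechet_derivative (x \<circ> \<psi>) (at u) v | D \<psi> u v. local_param M x D \<psi> \<and> u \<in> D \<and> \<psi> u = p}"

definition tangent_field ::
  "'m::topological_space set \<Rightarrow> ('m \<Rightarrow> 'n::finite minkowski) \<Rightarrow>
   ('m \<Rightarrow> 'n minkowski) \<Rightarrow> bool" where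
  "tangent_field M x X \<longleftrightarrow> smooth_map M x X \<and> (\<forall>p\<in>M. X p \<in> tangent_space M x p)"

text \<open>A subspace of Minkowski space on which the metric is non-degenerate has index 0 or 1, so
  the induced metric is then Riemannian or Lorentzian.\<close>

definition nondegenerate ::
  "'m::topological_space set \<Rightarrow> ('m \<Rightarrow> 'n::finite minkowski) \<Rightarrow> bool" where
  "nondegenerate M x \<longleftrightarrow>
     (\<forall>p\<in>M. \<forall>v\<in>tangent_space M x p.
        (\<forall>w\<in>tangent_space M x p. mink v w = 0) \<longrightarrow> v = 0)"

definition unit_normal_field ::
  "'m::topological_space set \<Rightarrow> ('m \<Rightarrow> 'n::finite minkowski) \<Rightarrow>
   ('m \<Rightarrow> 'n minkowski) \<Rightarrow> bool" where
  "unit_normal_field M x N \<longleftrightarrow>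
     smooth_map M x N \<and>
     (\<forall>p\<in>M. (\<forall>v\<in>tangent_space M x p. mink v (N p) = 0) \<and>
            (mink (N p) (N p) = 1 \<or> mink (N p) (N p) = - 1))"

text \<open>The orientation is given by the choice of the unit normal field \<open>N\<close>.\<close>

definition oriented_hypersurface ::
  "'m::topological_space set \<Rightarrow> ('m \<Rightarrow> 'n::finite minkowski) \<Rightarrow>
   ('m \<Rightarrow> 'n minkowski) \<Rightarrow> bool" where
  "oriented_hypersurface M x N \<longleftrightarrow>
     immersed_hypersurface M x \<and> nondegenerate M x \<and> unit_normal_field M x N"


section \<open>Shape operator and canonical principal directions\<close>

text \<open>The flat connection applied to a field \<open>V\<close> of ambient vectors along \<open>M\<close>, in the direction
  of the tangent vector \<open>X\<close> at \<open>p\<close>; the value does not depend on the parametrization.\<close>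

definition ambient_deriv ::
  "'m::topological_space set \<Rightarrow> ('m \<Rightarrow> 'n::finite minkowski) \<Rightarrow>
   ('m \<Rightarrow> 'n minkowski) \<Rightarrow> 'm \<Rightarrow> 'n minkowski \<Rightarrow> 'n minkowski" where
  "ambient_deriv M x V p X =
     (THE w. \<exists>D \<psi> u v. local_param M x D \<psi> \<and> u \<in> D \<and> \<psi> u = p \<and>
        frechet_derivative (x \<circ> \<psi>) (at u) v = X \<and>
        w = frechet_derivative (V \<circ> \<psi>) (at u) v)"

definition shape_operator ::
  "'m::topological_space set \<Rightarrow> ('m \<Rightarrow> 'n::finite minkowski) \<Rightarrow>
   ('m \<Rightarrow> 'n minkowski) \<Rightarrow> 'm \<Rightarrow> 'n minkowski \<Rightarrow> 'n minkowski" where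
  "shape_operator M x N p X = - ambient_deriv M x N p X"

definition tangential_part ::
  "('m \<Rightarrow> 'n::finite minkowski) \<Rightarrow> 'n minkowski \<Rightarrow> 'm \<Rightarrow> 'n minkowski" where
  "tangential_part N k p = k - (mink (N p) (N p) * mink k (N p)) *\<^sub>R N p"

definition CPD_hypersurface ::
  "'m::topological_space set \<Rightarrow> ('m \<Rightarrow> 'n::finite minkowski) \<Rightarrow>
   ('m \<Rightarrow> 'n minkowski) \<Rightarrow> 'n minkowski \<Rightarrow> bool" where
  "CPD_hypersurface M x N k \<longleftrightarrow>
     (\<exists>k1 :: 'm \<Rightarrow> real. smooth_map M x k1 \<and>
        (\<forall>p\<in>M. shape_operator M x N p (tangential_part N k p) = k1 p *\<^sub>R tangential_part N k p))"

text \<open>At points where \<open>U\<close> is space-like or time-like, \<open>e1\<close> is normalized by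
  \<open>\<langle>e1, e1\<rangle> = \<plusminus>1\<close> (either orientation along \<open>U\<close>); where \<open>U\<close> is light-like no such normalization
  is possible, and \<open>e1\<close> is normalized by \<open>k = \<phi> (e1 - N)\<close> instead.\<close>

definition unit_field_along_tangential_part ::
  "'m::topological_space set \<Rightarrow> ('m \<Rightarrow> 'n::finite minkowski) \<Rightarrow>
   ('m \<Rightarrow> 'n minkowski) \<Rightarrow> 'n minkowski \<Rightarrow> ('m \<Rightarrow> 'n minkowski) \<Rightarrow> bool" where
  "unit_field_along_tangential_part M x N k e1 \<longleftrightarrow>
     tangent_field M x e1 \<and>
     (\<forall>p\<in>M. \<exists>c. e1 p = c *\<^sub>R tangential_part N k p) \<and>
     (\<forall>p\<in>M. spacelike (tangential_part N k p) \<longrightarrow> mink (e1 p) (e1 p) = 1) \<and>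
     (\<forall>p\<in>M. timelike (tangential_part N k p) \<longrightarrow> mink (e1 p) (e1 p) = - 1) \<and>
     (\<exists>\<phi> :: 'm \<Rightarrow> real. \<forall>p\<in>M. lightlike (tangential_part N k p) \<longrightarrow>
        lightlike (e1 p) \<and> k = \<phi> p *\<^sub>R (e1 p - N p))"


section \<open>Curves and geodesics\<close>

text \<open>The domain \<open>I\<close> of a curve is an open interval, possibly unbounded.\<close>

definition smooth_curve ::
  "'m::topological_space set \<Rightarrow> ('m \<Rightarrow> 'n::finite minkowski) \<Rightarrow>
   real set \<Rightarrow> (real \<Rightarrow> 'm) \<Rightarrow> bool" where
  "smooth_curve M x I \<alpha> \<longleftrightarrow>
     open I \<and> is_interval I \<and> \<alpha> ` I \<subseteq> M \<and> continuous_on I \<alpha> \<and>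
     (\<forall>D \<psi>. local_param M x D \<psi> \<longrightarrow>
        smooth_on {t \<in> I. \<alpha> t \<in> \<psi> ` D} (the_inv_into D \<psi> \<circ> \<alpha>))"

definition integral_curve ::
  "'m::topological_space set \<Rightarrow> ('m \<Rightarrow> 'n::finite minkowski) \<Rightarrow>
   ('m \<Rightarrow> 'n minkowski) \<Rightarrow> real set \<Rightarrow> (real \<Rightarrow> 'm) \<Rightarrow> bool" where
  "integral_curve M x X I \<alpha> \<longleftrightarrow>
     smooth_curve M x I \<alpha> \<and>
     (\<forall>t\<in>I. ((x \<circ> \<alpha>) has_vector_derivative X (\<alpha> t)) (at t))"

definition induced_metric ::
  "('m \<Rightarrow> 'n::finite minkowski) \<Rightarrow> (real ^ 'n \<Rightarrow> 'm) \<Rightarrow>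
   real ^ 'n \<Rightarrow> real ^ 'n \<Rightarrow> real ^ 'n \<Rightarrow> real" where
  "induced_metric x \<psi> u v w =
     mink (frechet_derivative (x \<circ> \<psi>) (at u) v) (frechet_derivative (x \<circ> \<psi>) (at u) w)"

text \<open>Christoffel symbols of the first kind of the induced metric \<open>g\<close>, as a trilinear form: by the
  Koszul formula this is \<open>g (\<nabla>\<^sub>V W) Z\<close> at \<open>u\<close> for the Levi-Civita connection of \<open>M\<close> and the
  fields \<open>V\<close>, \<open>W\<close>, \<open>Z\<close> with constant coordinates \<open>v\<close>, \<open>w\<close>, \<open>z\<close>, which commute.\<close>

definition christoffel ::
  "('m \<Rightarrow> 'n::finite minkowski) \<Rightarrow> (real ^ 'n \<Rightarrow> 'm) \<Rightarrow>
   real ^ 'n \<Rightarrow> real ^ 'n \<Rightarrow> real ^ 'n \<Rightarrow> real ^ 'n \<Rightarrow> real" where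
  "christoffel x \<psi> u v w z =
     (frechet_derivative (\<lambda>q. induced_metric x \<psi> q w z) (at u) v
      + frechet_derivative (\<lambda>q. induced_metric x \<psi> q v z) (at u) w
      - frechet_derivative (\<lambda>q. induced_metric x \<psi> q v w) (at u) z) / 2"

text \<open>The equation says \<open>g (\<nabla> \<alpha>' \<alpha>') Z = 0\<close> for all \<open>Z\<close>, with \<open>\<nabla>\<close> the Levi-Civita connection of
  the induced metric. Since \<open>g\<close> is non-degenerate, this is \<open>\<nabla> \<alpha>' \<alpha>' = 0\<close>.\<close>

definition geodesic ::
  "'m::topological_space set \<Rightarrow> ('m \<Rightarrow> 'n::finite minkowski) \<Rightarrow>
   real set \<Rightarrow> (real \<Rightarrow> 'm) \<Rightarrow> bool" where
  "geodesic M x I \<alpha> \<longleftrightarrow>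
     smooth_curve M x I \<alpha> \<and>
     (\<forall>D \<psi>. local_param M x D \<psi> \<longrightarrow>
        (let c = the_inv_into D \<psi> \<circ> \<alpha>;
             c' = (\<lambda>t. vector_derivative c (at t));
             c'' = (\<lambda>t. vector_derivative c' (at t))
         in \<forall>t\<in>I. \<alpha> t \<in> \<psi> ` D \<longrightarrow>
              (\<forall>z. induced_metric x \<psi> (c t) (c'' t) z
                   + christoffel x \<psi> (c t) (c' t) (c' t) z = 0)))"

end

theory Submission
  imports Defs
begin

text \<open>Write \<open>\<epsilon> = \<langle>N, N\<rangle>\<close>, \<open>h = \<langle>k, N\<rangle>\<close> and \<open>e\<^sub>1 = c U\<close>. The ambient acceleration of an integral curve
  of \<open>e\<^sub>1\<close> is the derivative of \<open>e\<^sub>1\<close> along itself, and the curve is a geodesic iff this is normal to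
  \<open>M\<close>. Since \<open>k = U + \<epsilon> h N\<close> is constant, its tangential part is \<open>e\<^sub>1(c) U + c\<^sup>2 \<epsilon> h S(U)\<close>.
  If \<open>S(U)\<close> is a multiple of \<open>U\<close>, this is a multiple of \<open>U\<close>, and it vanishes because \<open>\<langle>e\<^sub>1, e\<^sub>1\<rangle>\<close> is
  constant, or, where \<open>U\<close> is light-like, because \<open>c\<close> and \<open>h\<close> are locally constant. Conversely, if
  it vanishes then \<open>h S(U)\<close> is a multiple of \<open>U\<close>. This settles the points where \<open>h \<noteq> 0\<close>, hence
  their limits, and where \<open>h = 0\<close> on an open set \<open>S(U) = 0\<close> because \<open>S(U)\<close> is minus the gradient
  of \<open>h\<close>. The converse needs an integral curve of \<open>e\<^sub>1\<close> through every point.\<close>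

section \<open>Calculus of smooth maps\<close>

text \<open>Geodesics are defined intrinsically, by an equation in every chart, and a chart is only
  a homeomorphism whose composition with \<open>x\<close> is a smooth immersion. Two facts bridge
  the gap to ambient space. A continuous map into a chart is smooth as soon as its composition with
  the immersion is, because its derivative solves a linear system with injective coefficients; hence
  transition maps and coordinates of curves are smooth. Second derivatives commute; this turns the
  geodesic equation into a condition on the ambient derivative of \<open>e1\<close>, and it makes
  the shape operator self-adjoint, which is the origin of the gradient formula for \<open>h\<close>.
  The factor \<open>k1\<close> cannot be found by dividing by <U,U>, which vanishes at light-like
  points. The principal direction condition is therefore stated as proportionality of two linear
  forms on the tangent space, and the factor is read off in any direction that pairs nontrivially
  with \<open>U\<close>; this also yields its smoothness. At light-like points differentiation is
  possible because <e1,e1> is continuous with values -1, 0, 1, so that \<open>U\<close> remains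
  light-like nearby.\<close>

lemma Ck_on_subset: "Ck_on k S f \<Longrightarrow> T \<subseteq> S \<Longrightarrow> Ck_on k T f"
  by (induction k arbitrary: f) (auto intro: continuous_on_subset)

lemma Ck_on_cong:
  \<comment> \<open>Openness of \<open>S\<close> is essential: \<open>frechet_derivative\<close> at
    a point depends on a whole neighbourhood, and agreement on an open set settles it.\<close>
  assumes "open S" "\<And>x. x \<in> S \<Longrightarrow> f x = g x"
  shows "Ck_on k S f \<longleftrightarrow> Ck_on k S g"
  using assms(2)
proof (induction k arbitrary: f g)
  case 0
  then show ?case by (simp cong: continuous_on_cong)
next
  case (Suc k)
  have fd: "(f has_derivative f') (at x) \<longleftrightarrow> (g has_derivative f') (at x)" if "x \<in> S" for x f'
    using has_derivative_transform_within_open[OF _ assms(1) that, of f f' UNIV g]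
      has_derivative_transform_within_open[OF _ assms(1) that, of g f' UNIV f] Suc.prems by metis
  then have "f differentiable (at x) \<longleftrightarrow> g differentiable (at x)" if "x \<in> S" for x
    using that by (auto simp: differentiable_def)
  moreover have "frechet_derivative f (at x) = frechet_derivative g (at x)" if "x \<in> S" for x
    using fd[OF that] by (simp add: frechet_derivative_def)
  then have "Ck_on k S (\<lambda>x. frechet_derivative f (at x) v) \<longleftrightarrow>
             Ck_on k S (\<lambda>x. frechet_derivative g (at x) v)" for v
    by (intro Suc.IH) auto
  ultimately show ?case by simp
qed

lemma Ck_on_SucI:
  assumes "open S" "\<And>x. x \<in> S \<Longrightarrow> (f has_derivative f' x) (at x)"
    and "\<And>v. Ck_on k S (\<lambda>x. f' x v)"
  shows "Ck_on (Suc k) S f"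
proof -
  have "frechet_derivative f (at x) = f' x" if "x \<in> S" for x
    using assms(2)[OF that] by (rule frechet_derivative_at[symmetric])
  then have "Ck_on k S (\<lambda>x. frechet_derivative f (at x) v)" for v
    using assms(3)[of v] Ck_on_cong[OF assms(1), of "\<lambda>x. frechet_derivative f (at x) v" "\<lambda>x. f' x v"] by auto
  then show ?thesis using assms(2) by (auto simp: differentiable_def)
qed

lemma Ck_on_SucD:
  "Ck_on (Suc k) S f \<Longrightarrow> Ck_on k S f"
proof (induction k arbitrary: f)
  case 0
  then show ?case
    by (auto intro!: continuous_at_imp_continuous_on differentiable_imp_continuous_within)
next
  case (Suc k)
  then show ?case
    unfolding Ck_on.simps(2)[of k S f] Ck_on.simps(2)[of "Suc k" S f] by blast
qed

lemma Ck_on_has_derivative: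
  "Ck_on (Suc k) S f \<Longrightarrow> x \<in> S \<Longrightarrow> (f has_derivative frechet_derivative f (at x)) (at x)"
  by (simp add: frechet_derivative_works[symmetric])

lemma Ck_on_derivative: "Ck_on (Suc k) S f \<Longrightarrow> Ck_on k S (\<lambda>x. frechet_derivative f (at x) v)"
  by simp

lemma Ck_on_local:
  assumes "\<And>x. x \<in> S \<Longrightarrow> \<exists>T. open T \<and> x \<in> T \<and> Ck_on k T f"
  shows "Ck_on k S f"
  using assms
proof (induction k arbitrary: f)
  case 0
  have "isCont f x" if "x \<in> S" for x
    using 0[OF that] by (auto simp: continuous_on_eq_continuous_at)
  then show ?case by (simp add: continuous_at_imp_continuous_on)
next
  case (Suc k)
  then have "f differentiable (at x)" if "x \<in> S" for x
    using that by fastforce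
  moreover have "Ck_on k S (\<lambda>x. frechet_derivative f (at x) v)" for v
  proof (rule Suc.IH)
    fix x assume "x \<in> S"
    from Suc.prems[OF this] obtain T where "open T \<and> x \<in> T \<and> Ck_on (Suc k) T f" by blast
    then show "\<exists>T. open T \<and> x \<in> T \<and> Ck_on k T (\<lambda>x. frechet_derivative f (at x) v)"
      by auto
  qed
  ultimately show ?case by simp
qed

lemma Ck_on_const: "open S \<Longrightarrow> Ck_on k S (\<lambda>x. c)"
  by (induction k arbitrary: c) auto

lemma Ck_on_add:
  assumes "open S" "Ck_on k S f" "Ck_on k S g"
  shows "Ck_on k S (\<lambda>x. f x + g x)"
  using assms(2,3)
proof (induction k arbitrary: f g)
  case 0
  then show ?case by (simp add: continuous_on_add)
next
  case (Suc k)
  note d = Suc.prems[THEN Ck_on_has_derivative]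
  show ?case
    by (rule Ck_on_SucI[OF assms(1) has_derivative_add[OF d]]) (use Suc in auto)
qed

lemma Ck_on_bilinear:
  assumes B: "bounded_bilinear B" and "open S" "Ck_on k S f" "Ck_on k S g"
  shows "Ck_on k S (\<lambda>x. B (f x) (g x))"
  using assms(3,4)
proof (induction k arbitrary: f g)
  case 0
  then show ?case unfolding Ck_on.simps by (rule bounded_bilinear.continuous_on[OF B])
next
  case (Suc k)
  note d = Suc.prems[THEN Ck_on_has_derivative]
  have "Ck_on k S (\<lambda>x. B (f x) (frechet_derivative g (at x) v)
      + B (frechet_derivative f (at x) v) (g x))" for v
    by (intro Ck_on_add[OF assms(2)] Suc.IH Suc.prems[THEN Ck_on_SucD] Suc.prems[THEN Ck_on_derivative])
  then show ?case
    by (intro Ck_on_SucI[OF assms(2) bounded_bilinear.FDERIV[OF B d]])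
qed

lemma Ck_on_sum:
  assumes "open S" "\<And>i. i \<in> I \<Longrightarrow> Ck_on k S (f i)"
  shows "Ck_on k S (\<lambda>x. \<Sum>i\<in>I. f i x)"
  using assms(2)
  by (induction I rule: infinite_finite_induct) (auto intro!: Ck_on_const Ck_on_add assms(1))

lemma Ck_on_prod:
  fixes f :: "'i \<Rightarrow> 'a::euclidean_space \<Rightarrow> real"
  assumes "open S" "\<And>i. i \<in> I \<Longrightarrow> Ck_on k S (f i)"
  shows "Ck_on k S (\<lambda>x. \<Prod>i\<in>I. f i x)"
  using assms(2)
  by (induction I rule: infinite_finite_induct)
    (auto intro!: Ck_on_const Ck_on_bilinear[OF bounded_bilinear_mult] assms(1))

text \<open>\<open>Ck_on\<close> controls derivatives in fixed directions only. The basis expansion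
  reduces a derivative in a varying direction, as in the chain rule, to these.\<close>

lemma has_derivative_basis_expansion:
  assumes "(f has_derivative f') F"
  shows "f' v = (\<Sum>b\<in>Basis. (v \<bullet> b) *\<^sub>R f' b)"
proof -
  interpret linear f' using assms by (rule has_derivative_linear)
  show ?thesis by (subst euclidean_representation[of v, symmetric]) (simp only: sum scale)
qed

lemma Ck_on_compose:
  assumes "open S" "Ck_on k T f" "Ck_on k S g" "g ` S \<subseteq> T"
  shows "Ck_on k S (\<lambda>x. f (g x))"
  using assms(2,3)
proof (induction k arbitrary: f)
  case 0
  then show ?case using assms(4) by (auto intro: continuous_on_compose2)
next
  case (Suc k)
  have f: "(f has_derivative frechet_derivative f (at (g x))) (at (g x))" if "x \<in> S" for x
    using Ck_on_has_derivative[OF Suc.prems(1)] assms(4) that by auto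
  note g = Ck_on_has_derivative[OF Suc.prems(2)]
  have "Ck_on k S (\<lambda>x. \<Sum>b\<in>Basis. (frechet_derivative g (at x) v \<bullet> b) *\<^sub>R
      frechet_derivative f (at (g x)) b)" for v
    by (intro Ck_on_sum assms(1) Ck_on_bilinear[OF bounded_bilinear_scaleR] Ck_on_const
        Ck_on_bilinear[OF bounded_bilinear_inner] Suc.IH Suc.prems[THEN Ck_on_SucD]
        Suc.prems[THEN Ck_on_derivative])
  then have "Ck_on k S (\<lambda>x. frechet_derivative f (at (g x)) (frechet_derivative g (at x) v))" for v
    by (subst Ck_on_cong[OF assms(1)], subst has_derivative_basis_expansion[OF f]) auto
  moreover have "((\<lambda>x. f (g x)) has_derivative
      (\<lambda>v. frechet_derivative f (at (g x)) (frechet_derivative g (at x) v))) (at x)" if "x \<in> S" for x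
    by (rule has_derivative_compose[OF g[OF that] f[OF that]])
  ultimately show ?case
    by (intro Ck_on_SucI[OF assms(1)]) auto
qed

lemma Ck_on_inverse:
  fixes f :: "'a::euclidean_space \<Rightarrow> real"
  assumes "open S" "Ck_on k S f" "\<And>x. x \<in> S \<Longrightarrow> f x \<noteq> 0"
  shows "Ck_on k S (\<lambda>x. inverse (f x))"
  using assms(2)
proof (induction k)
  case 0
  then show ?case using assms(3) by (auto intro: continuous_on_inverse)
next
  case (Suc k)
  have "Ck_on k S (\<lambda>x. (-1) * (inverse (f x) * (frechet_derivative f (at x) v * inverse (f x))))" for v
    by (intro Ck_on_bilinear[OF bounded_bilinear_mult] assms(1) Ck_on_const Suc.IH
        Ck_on_SucD[OF Suc.prems] Ck_on_derivative[OF Suc.prems])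
  then have "Ck_on k S (\<lambda>x. - (inverse (f x) * frechet_derivative f (at x) v * inverse (f x)))" for v
    by (simp add: mult.assoc)
  then show ?case
    by (intro Ck_on_SucI[OF assms(1) Deriv.has_derivative_inverse[OF assms(3) Ck_on_has_derivative[OF Suc.prems]]])
qed

lemma smooth_on_cong:
  "open S \<Longrightarrow> (\<And>x. x \<in> S \<Longrightarrow> f x = g x) \<Longrightarrow> smooth_on S f \<longleftrightarrow> smooth_on S g"
  unfolding smooth_on_def using Ck_on_cong by blast

lemma smooth_on_subset: "smooth_on S f \<Longrightarrow> T \<subseteq> S \<Longrightarrow> smooth_on T f"
  unfolding smooth_on_def using Ck_on_subset by blast

lemma smooth_on_imp_continuous_on: "smooth_on S f \<Longrightarrow> continuous_on S f"
  unfolding smooth_on_def using Ck_on.simps(1) by blast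

lemma smooth_on_has_derivative:
  "smooth_on S f \<Longrightarrow> x \<in> S \<Longrightarrow> (f has_derivative frechet_derivative f (at x)) (at x)"
  unfolding smooth_on_def using Ck_on_has_derivative by blast

lemma smooth_on_derivative: "smooth_on S f \<Longrightarrow> smooth_on S (\<lambda>x. frechet_derivative f (at x) v)"
  unfolding smooth_on_def using Ck_on_derivative by blast

lemma smooth_on_local:
  assumes "\<And>x. x \<in> S \<Longrightarrow> \<exists>T. open T \<and> x \<in> T \<and> smooth_on T f"
  shows "smooth_on S f"
  unfolding smooth_on_def by (intro allI Ck_on_local) (use assms smooth_on_def in blast)

lemma smooth_on_const: "open S \<Longrightarrow> smooth_on S (\<lambda>x. c)"
  by (simp add: smooth_on_def Ck_on_const)

lemma smooth_on_add:
  "open S \<Longrightarrow> smooth_on S f \<Longrightarrow> smooth_on S g \<Longrightarrow> smooth_on S (\<lambda>x. f x + g x)"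
  by (simp add: smooth_on_def Ck_on_add)

lemma smooth_on_bilinear:
  "bounded_bilinear B \<Longrightarrow> open S \<Longrightarrow> smooth_on S f \<Longrightarrow> smooth_on S g \<Longrightarrow>
    smooth_on S (\<lambda>x. B (f x) (g x))"
  by (simp add: smooth_on_def Ck_on_bilinear)

lemma smooth_on_compose:
  "open S \<Longrightarrow> smooth_on T f \<Longrightarrow> smooth_on S g \<Longrightarrow> g ` S \<subseteq> T \<Longrightarrow> smooth_on S (\<lambda>x. f (g x))"
  unfolding smooth_on_def using Ck_on_compose by blast

lemma smooth_on_divide:
  fixes f :: "'a::euclidean_space \<Rightarrow> real"
  assumes "open S" "smooth_on S f" "smooth_on S g" "\<And>x. x \<in> S \<Longrightarrow> g x \<noteq> 0"
  shows "smooth_on S (\<lambda>x. f x / g x)"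
  using assms unfolding smooth_on_def divide_inverse
  by (intro allI Ck_on_bilinear[OF bounded_bilinear_mult] Ck_on_inverse) auto

lemmas smooth_on_mult = smooth_on_bilinear[OF bounded_bilinear_mult]
lemmas smooth_on_scaleR = smooth_on_bilinear[OF bounded_bilinear_scaleR]
lemmas smooth_on_inner = smooth_on_bilinear[OF bounded_bilinear_inner]

lemma smooth_on_diff:
  assumes "open S" "smooth_on S f" "smooth_on S g"
  shows "smooth_on S (\<lambda>x. f x - g x)"
  using smooth_on_add[OF assms(1,2) smooth_on_scaleR[OF assms(1) smooth_on_const[OF assms(1), of "-1"] assms(3)]]
  by simp

section \<open>Symmetry of second derivatives\<close>

lemma mixed_difference_real:
  fixes f :: "'a::euclidean_space \<Rightarrow> real"
  assumes S: "open S" and f: "Ck_on 2 S f" and h: "h > 0"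
    and sub: "\<And>s t. 0 \<le> s \<Longrightarrow> s \<le> h \<Longrightarrow> 0 \<le> t \<Longrightarrow> t \<le> h \<Longrightarrow> u + s *\<^sub>R v + t *\<^sub>R w \<in> S"
  obtains s t where "0 < s" "s < h" "0 < t" "t < h"
    "f (u + h *\<^sub>R v + h *\<^sub>R w) - f (u + h *\<^sub>R v) - f (u + h *\<^sub>R w) + f u
      = h * (h * frechet_derivative (\<lambda>q. frechet_derivative f (at q) v) (at (u + s *\<^sub>R v + t *\<^sub>R w)) w)"
proof -
  have f1: "Ck_on (Suc (Suc 0)) S f" using f by (simp add: numeral_2_eq_2)
  note d1 = Ck_on_has_derivative[OF f1]
  note d2 = Ck_on_has_derivative[OF Ck_on_derivative[OF f1, of v]]
  \<comment> \<open>The mixed difference is the increment of \<open>g\<close>: the mean value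
    theorem is applied in direction \<open>v\<close>, and then to the resulting derivative in
    direction \<open>w\<close>.\<close>
  define g where "g s = f (u + s *\<^sub>R v + h *\<^sub>R w) - f (u + s *\<^sub>R v + 0 *\<^sub>R w)" for s
  have gd: "(g has_real_derivative (frechet_derivative f (at (u + s *\<^sub>R v + h *\<^sub>R w)) v
      - frechet_derivative f (at (u + s *\<^sub>R v + 0 *\<^sub>R w)) v)) (at s)" if "0 \<le> s" "s \<le> h" for s
  proof -
    have *: "((\<lambda>s. f (u + s *\<^sub>R v + r *\<^sub>R w)) has_real_derivative
        frechet_derivative f (at (u + s *\<^sub>R v + r *\<^sub>R w)) v) (at s)" if "0 \<le> r" "r \<le> h" for r
    proof -
      have m: "u + s *\<^sub>R v + r *\<^sub>R w \<in> S" using sub that \<open>0 \<le> s\<close> \<open>s \<le> h\<close> by auto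
      have "((\<lambda>s. u + s *\<^sub>R v + r *\<^sub>R w) has_derivative (\<lambda>d. d *\<^sub>R v)) (at s)"
        by (auto intro!: derivative_eq_intros)
      from has_derivative_compose[OF this d1[OF m]]
      have "((\<lambda>s. f (u + s *\<^sub>R v + r *\<^sub>R w)) has_derivative
        (\<lambda>d. frechet_derivative f (at (u + s *\<^sub>R v + r *\<^sub>R w)) (d *\<^sub>R v))) (at s)" .
      moreover have "frechet_derivative f (at (u + s *\<^sub>R v + r *\<^sub>R w)) (d *\<^sub>R v) =
          d *\<^sub>R frechet_derivative f (at (u + s *\<^sub>R v + r *\<^sub>R w)) v" for d
        using has_derivative_linear[OF d1[OF m]] by (rule linear_scale)
      ultimately show ?thesis
        by (simp add: has_field_derivative_def mult_commute_abs)
    qed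
    show ?thesis
      unfolding g_def using h by (intro DERIV_diff *) auto
  qed
  from MVT2[OF h gd] obtain s where s: "0 < s" "s < h" and gs: "g h - g 0 =
      (h - 0) * (frechet_derivative f (at (u + s *\<^sub>R v + h *\<^sub>R w)) v
      - frechet_derivative f (at (u + s *\<^sub>R v + 0 *\<^sub>R w)) v)" by blast
  define G where "G t = frechet_derivative f (at (u + s *\<^sub>R v + t *\<^sub>R w)) v" for t
  have Gd: "(G has_real_derivative frechet_derivative (\<lambda>q. frechet_derivative f (at q) v)
      (at (u + s *\<^sub>R v + t *\<^sub>R w)) w) (at t)" if "0 \<le> t" "t \<le> h" for t
  proof -
    let ?D = "frechet_derivative (\<lambda>q. frechet_derivative f (at q) v) (at (u + s *\<^sub>R v + t *\<^sub>R w))"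
    have m: "u + s *\<^sub>R v + t *\<^sub>R w \<in> S" using sub that s by auto
    have "((\<lambda>t. u + s *\<^sub>R v + t *\<^sub>R w) has_derivative (\<lambda>d. d *\<^sub>R w)) (at t)"
      by (auto intro!: derivative_eq_intros)
    from has_derivative_compose[OF this d2[OF m]]
    have "(G has_derivative (\<lambda>d. ?D (d *\<^sub>R w))) (at t)" by (simp add: G_def[abs_def])
    moreover have "?D (d *\<^sub>R w) = d *\<^sub>R ?D w" for d
      using has_derivative_linear[OF d2[OF m]] by (rule linear_scale)
    ultimately show ?thesis
      by (simp add: has_field_derivative_def mult_commute_abs)
  qed
  from MVT2[OF h Gd] obtain t where t: "0 < t" "t < h" and Gt: "G h - G 0 =
      (h - 0) * frechet_derivative (\<lambda>q. frechet_derivative f (at q) v) (at (u + s *\<^sub>R v + t *\<^sub>R w)) w"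
    by blast
  have "f (u + h *\<^sub>R v + h *\<^sub>R w) - f (u + h *\<^sub>R v) - f (u + h *\<^sub>R w) + f u = g h - g 0"
    by (simp add: g_def)
  also have "\<dots> = h * (G h - G 0)" using gs by (simp add: G_def)
  finally show ?thesis using that s t Gt by simp
qed

text \<open>The mixed difference is symmetric in \<open>v\<close> and \<open>w\<close>. Computed in
  both orders it equates the two second derivatives at two points near \<open>u\<close>, and
  continuity carries the equality to \<open>u\<close>.\<close>

lemma symmetric_second_derivative_real:
  fixes f :: "'a::euclidean_space \<Rightarrow> real"
  assumes S: "open S" "u \<in> S" and f: "Ck_on 2 S f"
  shows "frechet_derivative (\<lambda>q. frechet_derivative f (at q) v) (at u) w
       = frechet_derivative (\<lambda>q. frechet_derivative f (at q) w) (at u) v"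
proof -
  let ?A = "\<lambda>v w q. frechet_derivative (\<lambda>q. frechet_derivative f (at q) v) (at q) w"
  have f1: "Ck_on (Suc (Suc 0)) S f" using f by (simp add: numeral_2_eq_2)
  have cont: "isCont (?A v w) u" for v w
    using f1 S by (simp add: continuous_on_eq_continuous_at)
  have close: "\<forall>e>0. \<bar>?A v w u - ?A w v u\<bar> < e + e"
  proof (intro allI impI)
    fix e :: real assume e: "e > 0"
    obtain r where r: "r > 0" "ball u r \<subseteq> S" using S openE by blast
    obtain d1 where d1: "d1 > 0" "\<And>q. dist q u < d1 \<Longrightarrow> dist (?A v w q) (?A v w u) < e"
      using cont[of v w] e unfolding continuous_at_eps_delta by blast
    obtain d2 where d2: "d2 > 0" "\<And>q. dist q u < d2 \<Longrightarrow> dist (?A w v q) (?A w v u) < e"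
      using cont[of w v] e unfolding continuous_at_eps_delta by blast
    define d where "d = min r (min d1 d2)"
    have d: "d > 0" using r d1 d2 by (simp add: d_def)
    \<comment> \<open>At this scale the parallelogram spanned by the multiples of \<open>v\<close>
      and \<open>w\<close> stays within \<open>d\<close> of \<open>u\<close>; the summand 1 covers
      \<open>v = w = 0\<close>.\<close>
    define h where "h = d / (norm v + norm w + 1)"
    have h: "h > 0" using d by (simp add: h_def add_nonneg_pos)
    have hd: "h * (norm v + norm w) < d"
    proof -
      have "h * (norm v + norm w) < h * (norm v + norm w + 1)" using h by simp
      also have "\<dots> = d"
        using add_nonneg_pos[of "norm v + norm w" 1] by (simp add: h_def)
      finally show ?thesis .
    qed
    have near: "dist (u + s *\<^sub>R a + t *\<^sub>R b) u < d"
      if "0 \<le> s" "s \<le> h" "0 \<le> t" "t \<le> h" "(a = v \<and> b = w) \<or> (a = w \<and> b = v)" for s t a b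
    proof -
      have "dist (u + s *\<^sub>R a + t *\<^sub>R b) u = norm (s *\<^sub>R a + t *\<^sub>R b)" by (simp add: dist_norm)
      also have "\<dots> \<le> s * norm a + t * norm b"
        using norm_triangle_ineq[of "s *\<^sub>R a" "t *\<^sub>R b"] that by simp
      also have "\<dots> \<le> h * norm a + h * norm b" using that by (intro add_mono mult_right_mono) auto
      also have "\<dots> = h * (norm v + norm w)" using that by (auto simp: algebra_simps)
      finally show ?thesis using hd by simp
    qed
    have inS: "u + s *\<^sub>R a + t *\<^sub>R b \<in> S"
      if "0 \<le> s" "s \<le> h" "0 \<le> t" "t \<le> h" "(a = v \<and> b = w) \<or> (a = w \<and> b = v)" for s t a b
      using near[OF that] r by (auto simp: d_def dist_commute)
    obtain s t where st: "0 < s" "s < h" "0 < t" "t < h"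
      "f (u + h *\<^sub>R v + h *\<^sub>R w) - f (u + h *\<^sub>R v) - f (u + h *\<^sub>R w) + f u
        = h * (h * ?A v w (u + s *\<^sub>R v + t *\<^sub>R w))"
      using mixed_difference_real[OF S(1) f h, of u v w] inS by metis
    obtain s' t' where st': "0 < s'" "s' < h" "0 < t'" "t' < h"
      "f (u + h *\<^sub>R w + h *\<^sub>R v) - f (u + h *\<^sub>R w) - f (u + h *\<^sub>R v) + f u
        = h * (h * ?A w v (u + s' *\<^sub>R w + t' *\<^sub>R v))"
      using mixed_difference_real[OF S(1) f h, of u w v] inS by metis
    have "f (u + h *\<^sub>R w + h *\<^sub>R v) = f (u + h *\<^sub>R v + h *\<^sub>R w)" by (simp add: algebra_simps)
    then have "h * (h * ?A v w (u + s *\<^sub>R v + t *\<^sub>R w)) = h * (h * ?A w v (u + s' *\<^sub>R w + t' *\<^sub>R v))"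
      using st(5) st'(5) by linarith
    then have eq: "?A v w (u + s *\<^sub>R v + t *\<^sub>R w) = ?A w v (u + s' *\<^sub>R w + t' *\<^sub>R v)"
      using h by simp
    have "dist (?A v w (u + s *\<^sub>R v + t *\<^sub>R w)) (?A v w u) < e"
      using near[of s t v w] st by (intro d1) (auto simp: d_def)
    moreover have "dist (?A w v (u + s' *\<^sub>R w + t' *\<^sub>R v)) (?A w v u) < e"
      using near[of s' t' w v] st' by (intro d2) (auto simp: d_def)
    ultimately show "\<bar>?A v w u - ?A w v u\<bar> < e + e"
      unfolding eq dist_real_def by linarith
  qed
  show ?thesis
  proof (rule ccontr)
    assume "\<not> ?thesis"
    then show False using close[rule_format, of "\<bar>?A v w u - ?A w v u\<bar> / 2"] by simp
  qed
qed

lemma symmetric_second_derivative: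
  fixes f :: "'a::euclidean_space \<Rightarrow> 'b::euclidean_space"
  assumes S: "open S" "u \<in> S" and f: "smooth_on S f"
  shows "frechet_derivative (\<lambda>q. frechet_derivative f (at q) v) (at u) w
       = frechet_derivative (\<lambda>q. frechet_derivative f (at q) w) (at u) v"
proof (rule euclidean_eqI)
  fix b :: 'b assume "b \<in> Basis"
  have smooth: "smooth_on S (\<lambda>q. f q \<bullet> b)"
    using S f by (intro smooth_on_inner smooth_on_const)
  have "frechet_derivative (\<lambda>q. frechet_derivative f (at q) v) (at u) w \<bullet> b
      = frechet_derivative (\<lambda>q. frechet_derivative (\<lambda>q. f q \<bullet> b) (at q) v) (at u) w" for v w
  proof -
    have 1: "frechet_derivative (\<lambda>q. f q \<bullet> b) (at q) v = frechet_derivative f (at q) v \<bullet> b"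
      if "q \<in> S" for q
      using has_derivative_inner_left[OF smooth_on_has_derivative[OF f that], of b]
      by (simp add: frechet_derivative_at[symmetric])
    have "((\<lambda>q. frechet_derivative f (at q) v \<bullet> b) has_derivative
        (\<lambda>w. frechet_derivative (\<lambda>q. frechet_derivative f (at q) v) (at u) w \<bullet> b)) (at u)"
      by (intro has_derivative_inner_left smooth_on_has_derivative[OF smooth_on_derivative[OF f]] S)
    then have "((\<lambda>q. frechet_derivative (\<lambda>q. f q \<bullet> b) (at q) v) has_derivative
        (\<lambda>w. frechet_derivative (\<lambda>q. frechet_derivative f (at q) v) (at u) w \<bullet> b)) (at u)"
      by (rule has_derivative_transform_within_open[OF _ S]) (simp add: 1)
    then show ?thesis by (simp add: frechet_derivative_at[symmetric])
  qed
  then show "frechet_derivative (\<lambda>q. frechet_derivative f (at q) v) (at u) w \<bullet> b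
      = frechet_derivative (\<lambda>q. frechet_derivative f (at q) w) (at u) v \<bullet> b"
    using symmetric_second_derivative_real[OF S, of "\<lambda>q. f q \<bullet> b" v w] smooth
    by (simp add: smooth_on_def)
qed

section \<open>Linear systems and lifts through immersions\<close>

lemma Ck_on_det:
  fixes M :: "'a::euclidean_space \<Rightarrow> real^'n^'n"
  assumes "open S" "\<And>i j. Ck_on k S (\<lambda>u. M u $ i $ j)"
  shows "Ck_on k S (\<lambda>u. det (M u))"
  unfolding det_def
  by (intro Ck_on_sum Ck_on_bilinear[OF bounded_bilinear_mult] Ck_on_const Ck_on_prod assms)

lemma Ck_on_vec_componentwise:
  fixes w :: "'a::euclidean_space \<Rightarrow> real^'n"
  assumes "open S" "\<And>i. Ck_on k S (\<lambda>u. w u $ i)"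
  shows "Ck_on k S w"
proof -
  have "Ck_on k S (\<lambda>u. \<Sum>i\<in>UNIV. (w u $ i) *\<^sub>R axis i 1)"
    by (intro Ck_on_sum Ck_on_bilinear[OF bounded_bilinear_scaleR] Ck_on_const assms)
  moreover have "(\<lambda>u. \<Sum>i\<in>UNIV. (w u $ i) *\<^sub>R axis i 1) = w"
    using basis_expansion[of "w _"] by (simp add: fun_eq_iff scalar_mult_eq_scaleR)
  ultimately show ?thesis by (rule back_subst)
qed

text \<open>Cramer's rule for the normal equations, whose Gram matrix is invertible since \<open>A u\<close> is
  injective.\<close>

lemma Ck_on_solve:
  fixes A :: "'a::euclidean_space \<Rightarrow> real^'n \<Rightarrow> 'b::euclidean_space"
  assumes S: "open S" and A: "\<And>v. Ck_on k S (\<lambda>u. A u v)"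
    and lin: "\<And>u. u \<in> S \<Longrightarrow> linear (A u)" and inj: "\<And>u. u \<in> S \<Longrightarrow> inj (A u)"
    and g: "Ck_on k S g" and eq: "\<And>u. u \<in> S \<Longrightarrow> A u (w u) = g u"
  shows "Ck_on k S w"
proof -
  define G :: "'a \<Rightarrow> real^'n^'n" where
    "G u = (\<chi> i j. A u (axis i 1) \<bullet> A u (axis j 1))" for u
  define b :: "'a \<Rightarrow> real^'n" where "b u = (\<chi> i. A u (axis i 1) \<bullet> g u)" for u
  have expand: "A u z = (\<Sum>j\<in>UNIV. (z $ j) *\<^sub>R A u (axis j 1))" if "u \<in> S" for u z
  proof -
    interpret linear "A u" using lin that .
    show ?thesis
      by (subst basis_expansion[of z, symmetric]) (simp add: scalar_mult_eq_scaleR sum scale)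
  qed
  have Gz: "(G u *v z) $ i = A u (axis i 1) \<bullet> A u z" if "u \<in> S" for u z i
    by (subst expand[OF that, of z])
      (simp add: G_def matrix_vector_mult_def inner_sum_right mult.commute)
  have det: "det (G u) \<noteq> 0" if u: "u \<in> S" for u
  proof -
    have "z = 0" if "G u *v z = 0" for z
    proof -
      have "A u z \<bullet> A u z = (\<Sum>i\<in>UNIV. z $ i * (G u *v z) $ i)"
        unfolding Gz[OF u] by (subst (1) expand[OF u, of z]) (simp add: inner_sum_left)
      also have "\<dots> = 0" using that by simp
      finally have "A u z = A u 0" using lin[OF u] by (simp add: linear_0)
      then show ?thesis using inj[OF u] by (auto dest: injD)
    qed
    then show ?thesis
      using invertible_det_nz[of "G u"] invertible_left_inverse[of "G u"]
        matrix_left_invertible_ker[of "G u"] by auto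
  qed
  have "w u $ i = det (\<chi> l j. if j = i then b u $ l else G u $ l $ j) * inverse (det (G u))"
    if "u \<in> S" for u i
  proof -
    have "G u *v w u = b u"
      using that by (simp add: vec_eq_iff Gz b_def eq)
    then show ?thesis
      using cramer[OF det[OF that], of "w u" "b u"] by (simp add: divide_inverse)
  qed
  moreover have "Ck_on k S (\<lambda>u. det (\<chi> l j. if j = i then b u $ l else G u $ l $ j) * inverse (det (G u)))"
    for i
  proof -
    have G: "Ck_on k S (\<lambda>u. G u $ l $ j)" for l j
      unfolding G_def using A by (simp add: Ck_on_bilinear[OF bounded_bilinear_inner S])
    have b: "Ck_on k S (\<lambda>u. b u $ l)" for l
      unfolding b_def using A g by (simp add: Ck_on_bilinear[OF bounded_bilinear_inner S])
    have "Ck_on k S (\<lambda>u. det (\<chi> l j. if j = i then b u $ l else G u $ l $ j))"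
    proof (rule Ck_on_det[OF S])
      fix l j
      show "Ck_on k S (\<lambda>u. (\<chi> l j. if j = i then b u $ l else G u $ l $ j) $ l $ j)"
        using G b by (cases "j = i") simp_all
    qed
    moreover have "Ck_on k S (\<lambda>u. inverse (det (G u)))"
      by (intro S Ck_on_inverse Ck_on_det G det)
    ultimately show ?thesis
      by (rule Ck_on_bilinear[OF bounded_bilinear_mult S])
  qed
  ultimately have "Ck_on k S (\<lambda>u. w u $ i)" for i
    using Ck_on_cong[OF S, of "\<lambda>u. w u $ i"
        "\<lambda>u. det (\<chi> l j. if j = i then b u $ l else G u $ l $ j) * inverse (det (G u))"] by simp
  then show ?thesis by (rule Ck_on_vec_componentwise[OF S])
qed

text \<open>Only continuity of \<open>h\<close> is known. Applying \<open>L\<close> to the expansion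
  of \<open>y\<close> recovers \<open>h q - h u\<close> up to an error small against
  \<open>norm (h q - h u)\<close>; a Lipschitz bound at \<open>u\<close> makes it small against
  \<open>norm (q - u)\<close>.\<close>

lemma has_derivative_lift:
  fixes h :: "'a::euclidean_space \<Rightarrow> 'c::euclidean_space" and y :: "'c \<Rightarrow> 'b::euclidean_space"
  assumes cont: "isCont h u" and y: "(y has_derivative A) (at (h u))"
    and f: "(f has_derivative f') (at u)" and eq: "\<forall>\<^sub>F q in at u. y (h q) = f q" "y (h u) = f u"
    and L: "linear L" "L \<circ> A = id"
  shows "(h has_derivative L \<circ> f') (at u)"
proof -
  have bl: "bounded_linear L" using L(1) by (simp add: linear_conv_bounded_linear)
  have bf: "bounded_linear f'" using f by (rule has_derivative_bounded_linear)
  interpret L: bounded_linear L by (rule bl)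
  obtain K where K: "K > 0" "\<And>z. norm (L z) \<le> norm z * K" using L.pos_bounded by blast
  obtain K' where K': "K' > 0" "\<And>z. norm (f' z) \<le> norm z * K'"
    using bounded_linear.pos_bounded[OF bf] by blast
  have y_est: "\<exists>d>0. \<forall>q. norm (q - u) < d \<longrightarrow> y (h q) = f q \<and>
      norm (L (y (h q) - y (h u)) - (h q - h u)) \<le> (K * e) * norm (h q - h u)" if e: "e > 0" for e
  proof -
    obtain d1 where d1: "d1 > 0" "\<And>z. norm (z - h u) < d1 \<Longrightarrow>
        norm (y z - y (h u) - A (z - h u)) \<le> e * norm (z - h u)"
      using y[unfolded has_derivative_at_alt, THEN conjunct2, rule_format, OF e] by blast
    obtain d2 where d2: "d2 > 0" "\<And>q. dist q u < d2 \<Longrightarrow> dist (h q) (h u) < d1"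
      using cont d1(1) unfolding continuous_at_eps_delta by blast
    obtain d3 where d3: "d3 > 0" "\<And>q. q \<noteq> u \<Longrightarrow> dist q u < d3 \<Longrightarrow> y (h q) = f q"
      using eq(1) unfolding eventually_at by blast
    show ?thesis
    proof (intro exI[of _ "min d2 d3"] conjI allI impI)
      show "min d2 d3 > 0" using d2 d3 by simp
      fix q assume q: "norm (q - u) < min d2 d3"
      show "y (h q) = f q" using q d3 eq(2) by (cases "q = u") (auto simp: dist_norm)
      have "L (y (h q) - y (h u)) - (h q - h u) = L (y (h q) - y (h u) - A (h q - h u))"
        using L(2) by (simp add: L.diff o_def fun_eq_iff)
      also have "norm \<dots> \<le> norm (y (h q) - y (h u) - A (h q - h u)) * K" by (rule K)
      also have "\<dots> \<le> (e * norm (h q - h u)) * K"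
        using d1(2)[of "h q"] d2(2)[of q] q K(1) by (intro mult_right_mono) (auto simp: dist_norm)
      finally show "norm (L (y (h q) - y (h u)) - (h q - h u)) \<le> (K * e) * norm (h q - h u)"
        by (simp add: mult_ac)
    qed
  qed
  have f_est: "\<exists>d>0. \<forall>q. norm (q - u) < d \<longrightarrow>
      norm (L (f q - f u) - L (f' (q - u))) \<le> (K * e) * norm (q - u)" if e: "e > 0" for e
  proof -
    obtain d where d: "d > 0" "\<And>q. norm (q - u) < d \<Longrightarrow>
        norm (f q - f u - f' (q - u)) \<le> e * norm (q - u)"
      using f[unfolded has_derivative_at_alt, THEN conjunct2, rule_format, OF e] by blast
    have "norm (L (f q - f u) - L (f' (q - u))) \<le> (K * e) * norm (q - u)"
      if "norm (q - u) < d" for q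
    proof -
      have "norm (L (f q - f u) - L (f' (q - u))) = norm (L (f q - f u - f' (q - u)))"
        by (simp add: L.diff)
      also have "\<dots> \<le> norm (f q - f u - f' (q - u)) * K" by (rule K)
      also have "\<dots> \<le> (e * norm (q - u)) * K"
        using d(2)[OF that] K(1) by (intro mult_right_mono) auto
      finally show ?thesis by (simp add: mult_ac)
    qed
    with d show ?thesis by blast
  qed
  \<comment> \<open>The derivative of y is bounded below, so the lift is Lipschitz at u.\<close>
  obtain d0 where d0: "d0 > 0" "\<And>q. norm (q - u) < d0 \<Longrightarrow>
      norm (h q - h u) \<le> (2 * K * (1 + K')) * norm (q - u)"
  proof -
    \<comment> \<open>With accuracy \<open>1 / (2 * K)\<close> the error is at most half of
      \<open>norm (h q - h u)\<close> and can be absorbed on the left; this is the factor 2 in the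
      Lipschitz constant.\<close>
    obtain d1 where d1: "d1 > 0" "\<And>q. norm (q - u) < d1 \<Longrightarrow> y (h q) = f q \<and>
        norm (L (y (h q) - y (h u)) - (h q - h u)) \<le> (K * (1 / (2 * K))) * norm (h q - h u)"
      using y_est[of "1 / (2 * K)"] K by auto
    obtain d2 where d2: "d2 > 0" "\<And>q. norm (q - u) < d2 \<Longrightarrow>
        norm (L (f q - f u) - L (f' (q - u))) \<le> (K * 1) * norm (q - u)"
      using f_est[of 1] by auto
    have "norm (h q - h u) \<le> (2 * K * (1 + K')) * norm (q - u)" if q: "norm (q - u) < min d1 d2" for q
    proof -
      have 1: "norm (L (f q - f u) - (h q - h u)) \<le> norm (h q - h u) / 2"
        using d1(2)[of q] q K(1) eq(2) by auto
      have 2: "norm (L (f q - f u) - L (f' (q - u))) \<le> K * norm (q - u)"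
        using d2(2)[of q] q by simp
      have "norm (L (f' (q - u))) \<le> norm (f' (q - u)) * K" by (rule K)
      also have "\<dots> \<le> (norm (q - u) * K') * K" using K' K(1) by (intro mult_right_mono) auto
      finally have 3: "norm (L (f' (q - u))) \<le> K * K' * norm (q - u)" by (simp add: mult_ac)
      have "norm (h q - h u) \<le> norm (L (f q - f u) - (h q - h u))
          + norm (L (f q - f u) - L (f' (q - u))) + norm (L (f' (q - u)))"
        by norm
      with 1 2 3 show ?thesis by (simp add: algebra_simps)
    qed
    then show ?thesis using that[of "min d1 d2"] d1 d2 by auto
  qed
  have Cpos: "2 * K * (1 + K') > 0" using K K' by simp
  show ?thesis
    unfolding has_derivative_at_alt
  proof (intro conjI allI impI)
    show "bounded_linear (L \<circ> f')" using bl bf by (simp add: o_def bounded_linear_compose)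
    fix e :: real assume e: "e > 0"
    \<comment> \<open>Both accuracies are chosen to contribute \<open>e / 2\<close>: here the
      Lipschitz constant \<open>2 * K * (1 + K')\<close> is divided out as well, for
      \<open>d2\<close> only the bound \<open>K\<close> of \<open>L\<close>.\<close>
    obtain d1 where d1: "d1 > 0" "\<And>q. norm (q - u) < d1 \<Longrightarrow> y (h q) = f q \<and>
        norm (L (y (h q) - y (h u)) - (h q - h u))
          \<le> (K * (e / (2 * K * (2 * K * (1 + K'))))) * norm (h q - h u)"
      using y_est[of "e / (2 * K * (2 * K * (1 + K')))"] e K Cpos by auto
    obtain d2 where d2: "d2 > 0" "\<And>q. norm (q - u) < d2 \<Longrightarrow>
        norm (L (f q - f u) - L (f' (q - u))) \<le> (K * (e / (2 * K))) * norm (q - u)"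
      using f_est[of "e / (2 * K)"] e K by auto
    show "\<exists>d>0. \<forall>q. norm (q - u) < d \<longrightarrow>
        norm (h q - h u - (L \<circ> f') (q - u)) \<le> e * norm (q - u)"
    proof (intro exI[of _ "min d0 (min d1 d2)"] conjI allI impI)
      show "min d0 (min d1 d2) > 0" using d0 d1 d2 by simp
      fix q assume q: "norm (q - u) < min d0 (min d1 d2)"
      have coeff: "K * (e / (2 * K * (2 * K * (1 + K')))) = e / 2 / (2 * K * (1 + K'))"
        using K(1) by simp
      have "norm (L (f q - f u) - (h q - h u)) \<le> (e / 2 / (2 * K * (1 + K'))) * norm (h q - h u)"
        using d1(2)[of q] q eq(2) unfolding coeff by auto
      also have "\<dots> \<le> (e / 2 / (2 * K * (1 + K'))) * ((2 * K * (1 + K')) * norm (q - u))"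
        using d0(2)[of q] q e Cpos by (intro mult_left_mono) auto
      also have "\<dots> = e / 2 * norm (q - u)"
      proof -
        have "e / 2 / C * (C * r) = e / 2 * r" if "C > 0" for C r :: real using that by simp
        from this[OF Cpos] show ?thesis .
      qed
      finally have 1: "norm (L (f q - f u) - (h q - h u)) \<le> e / 2 * norm (q - u)" .
      have 2: "norm (L (f q - f u) - L (f' (q - u))) \<le> e / 2 * norm (q - u)"
        using d2(2)[of q] q K(1) by simp
      have "norm (h q - h u - L (f' (q - u))) \<le> norm (L (f q - f u) - (h q - h u))
          + norm (L (f q - f u) - L (f' (q - u)))"
        by norm
      also have "\<dots> \<le> e * norm (q - u)" using 1 2 by (simp add: field_simps)
      finally show "norm (h q - h u - (L \<circ> f') (q - u)) \<le> e * norm (q - u)" by simp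
    qed
  qed
qed

text \<open>Bootstrapping: the derivative of \<open>h\<close> solves an injective linear system
  whose coefficients are of class C^k once \<open>h\<close> is, so \<open>h\<close> gains one
  derivative per round.\<close>

lemma smooth_on_lift:
  fixes h :: "'a::euclidean_space \<Rightarrow> real^'n" and y :: "real^'n \<Rightarrow> 'b::euclidean_space"
  assumes S: "open S" and h: "continuous_on S h" "h ` S \<subseteq> D"
    and y: "smooth_on D y" "\<And>q. q \<in> D \<Longrightarrow> inj (frechet_derivative y (at q))"
    and f: "smooth_on S f" and eq: "\<And>u. u \<in> S \<Longrightarrow> y (h u) = f u"
  shows "smooth_on S h"
proof -
  have hd: "(h has_derivative frechet_derivative h (at u)) (at u)" if u: "u \<in> S" for u
  proof -
    have hu: "h u \<in> D" using h u by auto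
    note yd = smooth_on_has_derivative[OF y(1) hu]
    obtain L where L: "linear L" "L \<circ> frechet_derivative y (at (h u)) = id"
      using linear_injective_left_inverse[OF has_derivative_linear[OF yd] y(2)[OF hu]] by blast
    have "isCont h u" using h(1) S u by (simp add: continuous_on_eq_continuous_at)
    moreover have "\<forall>\<^sub>F q in at u. y (h q) = f q"
      using S u eq by (auto intro: eventually_at_in_open' eventually_mono)
    ultimately show ?thesis
      using has_derivative_lift[of u h y, OF _ yd smooth_on_has_derivative[OF f u] _ _ L] eq[OF u]
      by (metis frechet_derivative_at)
  qed
  have hd_eq: "frechet_derivative y (at (h u)) (frechet_derivative h (at u) v) = frechet_derivative f (at u) v"
    if u: "u \<in> S" for u v
  proof -
    have hu: "h u \<in> D" using h u by auto
    have "((\<lambda>u. y (h u)) has_derivative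
        (\<lambda>v. frechet_derivative y (at (h u)) (frechet_derivative h (at u) v))) (at u)"
      by (rule has_derivative_compose[OF hd[OF u] smooth_on_has_derivative[OF y(1) hu]])
    then have "(f has_derivative
        (\<lambda>v. frechet_derivative y (at (h u)) (frechet_derivative h (at u) v))) (at u)"
      by (rule has_derivative_transform_within_open[OF _ S u]) (use eq in auto)
    then show ?thesis by (simp add: frechet_derivative_at[symmetric])
  qed
  have "Ck_on k S h" for k
  proof (induction k)
    case 0
    then show ?case using h by simp
  next
    case (Suc k)
    have "Ck_on k S (\<lambda>u. frechet_derivative h (at u) v)" for v
    proof (rule Ck_on_solve[OF S])
      show "Ck_on k S (\<lambda>u. frechet_derivative y (at (h u)) v)" for v
        using Ck_on_compose[OF S _ Suc h(2), of "\<lambda>q. frechet_derivative y (at q) v"]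
          smooth_on_derivative[OF y(1)] by (simp add: smooth_on_def)
      show "linear (frechet_derivative y (at (h u)))" if "u \<in> S" for u
        using h(2) that by (intro has_derivative_linear[OF smooth_on_has_derivative[OF y(1)]]) auto
      show "inj (frechet_derivative y (at (h u)))" if "u \<in> S" for u
        using h(2) that y(2) by auto
      show "Ck_on k S (\<lambda>u. frechet_derivative f (at u) v)"
        using smooth_on_derivative[OF f] by (simp add: smooth_on_def)
    qed (simp add: hd_eq)
    then show ?case using hd by (intro Ck_on_SucI[OF S hd])
  qed
  then show ?thesis by (simp add: smooth_on_def)
qed

text \<open>Meant for a tangent field written through its coordinates: the base point and the
  direction vary together, and the product rule separates the two contributions.\<close>

lemma has_derivative_frechet_derivative_apply:
  fixes y :: "'a::euclidean_space \<Rightarrow> 'b::euclidean_space"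
  assumes D: "open D" "u \<in> D" and y: "smooth_on D y" and w: "(w has_derivative w') (at u)"
  shows "((\<lambda>q. frechet_derivative y (at q) (w q)) has_derivative
     (\<lambda>d. frechet_derivative (\<lambda>q. frechet_derivative y (at q) (w u)) (at u) d
          + frechet_derivative y (at u) (w' d))) (at u)"
proof -
  have expand: "frechet_derivative y (at q) v = (\<Sum>b\<in>Basis. (v \<bullet> b) *\<^sub>R frechet_derivative y (at q) b)"
    if "q \<in> D" for q v
    by (rule has_derivative_basis_expansion[OF smooth_on_has_derivative[OF y that]])
  have gen: "((\<lambda>q. frechet_derivative y (at q) (w q)) has_derivative
     (\<lambda>d. (\<Sum>b\<in>Basis. (w u \<bullet> b) *\<^sub>R frechet_derivative (\<lambda>q. frechet_derivative y (at q) b) (at u) d)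
          + frechet_derivative y (at u) (w' d))) (at u)"
    if w: "(w has_derivative w') (at u)" for w w'
  proof -
    have "((\<lambda>q. \<Sum>b\<in>Basis. (w q \<bullet> b) *\<^sub>R frechet_derivative y (at q) b) has_derivative
        (\<lambda>d. \<Sum>b\<in>Basis. (w u \<bullet> b) *\<^sub>R frechet_derivative (\<lambda>q. frechet_derivative y (at q) b) (at u) d
          + (w' d \<bullet> b) *\<^sub>R frechet_derivative y (at u) b)) (at u)"
      by (intro has_derivative_sum has_derivative_scaleR has_derivative_inner_left w
          smooth_on_has_derivative[OF smooth_on_derivative[OF y] D(2)])
    then have "((\<lambda>q. frechet_derivative y (at q) (w q)) has_derivative
        (\<lambda>d. \<Sum>b\<in>Basis. (w u \<bullet> b) *\<^sub>R frechet_derivative (\<lambda>q. frechet_derivative y (at q) b) (at u) d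
          + (w' d \<bullet> b) *\<^sub>R frechet_derivative y (at u) b)) (at u)"
      by (rule has_derivative_transform_within_open[OF _ D]) (rule expand[symmetric])
    then show ?thesis by (simp add: sum.distrib expand[OF D(2), of "w' _"])
  qed
  have "frechet_derivative (\<lambda>q. frechet_derivative y (at q) (w u)) (at u)
      = (\<lambda>d. \<Sum>b\<in>Basis. (w u \<bullet> b) *\<^sub>R frechet_derivative (\<lambda>q. frechet_derivative y (at q) b) (at u) d)"
    using gen[of "\<lambda>_. w u" "\<lambda>_. 0"] linear_0[OF has_derivative_linear[OF smooth_on_has_derivative[OF y D(2)]]]
    by (simp add: frechet_derivative_at[symmetric])
  then show ?thesis using gen[OF w] by simp
qed

section \<open>Local flows\<close>

text \<open>Compactness bounds the partial derivatives, and convexity of the ball turns a bound on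
  the operator norm into a Lipschitz constant.\<close>

lemma Ck_on_1_lipschitz_on_cball:
  fixes F :: "'a::euclidean_space \<Rightarrow> 'b::euclidean_space"
  assumes F: "Ck_on 1 S F" "cball u r \<subseteq> S"
  obtains L where "L \<ge> 0" "\<And>a b. a \<in> cball u r \<Longrightarrow> b \<in> cball u r \<Longrightarrow> norm (F a - F b) \<le> L * norm (a - b)"
proof -
  have F1: "Ck_on (Suc 0) (cball u r) F" using Ck_on_subset[OF F] by simp
  have "\<exists>M. \<forall>q\<in>cball u r. norm (frechet_derivative F (at q) b) \<le> M" for b
  proof -
    have "compact ((\<lambda>q. frechet_derivative F (at q) b) ` cball u r)"
      using F1 by (intro compact_continuous_image) auto
    then have "bounded ((\<lambda>q. frechet_derivative F (at q) b) ` cball u r)" by (rule compact_imp_bounded)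
    then show ?thesis unfolding bounded_iff by blast
  qed
  then obtain M where M: "\<And>b q. q \<in> cball u r \<Longrightarrow> norm (frechet_derivative F (at q) b) \<le> M b" by metis
  define L where "L = (\<Sum>b\<in>Basis. \<bar>M b\<bar>)"
  have "onorm (frechet_derivative F (at q)) \<le> L" if q: "q \<in> cball u r" for q
  proof (rule onorm_le)
    fix v
    have "norm (frechet_derivative F (at q) v)
        \<le> (\<Sum>b\<in>Basis. norm ((v \<bullet> b) *\<^sub>R frechet_derivative F (at q) b))"
      by (subst has_derivative_basis_expansion[OF Ck_on_has_derivative[OF F1 q]]) (rule norm_sum)
    also have "\<dots> \<le> (\<Sum>b\<in>Basis. norm v * \<bar>M b\<bar>)"
      using M[OF q] by (intro sum_mono) (auto intro!: mult_mono Basis_le_norm intro: order_trans[OF _ abs_ge_self])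
    finally show "norm (frechet_derivative F (at q) v) \<le> L * norm v"
      by (simp add: L_def sum_distrib_left mult.commute)
  qed
  then have "norm (F a - F b) \<le> L * norm (a - b)" if "a \<in> cball u r" "b \<in> cball u r" for a b
    using that Ck_on_has_derivative[OF F1]
    by (intro differentiable_bound[OF convex_cball, of u r F "\<lambda>q. frechet_derivative F (at q)"])
      (auto intro: has_derivative_at_withinI)
  then show ?thesis using that[of L] by (simp add: L_def sum_nonneg)
qed

lemma integral_norm_bound_Icc:
  fixes f :: "real \<Rightarrow> 'b::euclidean_space"
  assumes "continuous_on {a..b} f" "\<And>s. norm (f s) \<le> B" "a \<le> x" "x \<le> b"
  shows "norm (integral {a..x} f) \<le> B * (b - a)"
proof -
  have B: "0 \<le> B" using assms(2)[of a] norm_ge_zero order_trans by blast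
  have "norm (integral {a..x} f) \<le> B * (x - a)"
    using assms by (intro integral_bound) (auto intro: continuous_on_subset)
  also have "\<dots> \<le> B * (b - a)" using assms(4) B by (simp add: mult_left_mono)
  finally show ?thesis .
qed

text \<open>Picard iteration; the integrals start at the left end of the interval to avoid oriented
  integrals.\<close>

lemma ode_existence_lipschitz:
  fixes G :: "'a::euclidean_space \<Rightarrow> 'a"
  assumes L: "\<And>a b. norm (G a - G b) \<le> L * norm (a - b)" and M: "\<And>a. norm (G a) \<le> M"
    and d: "d > 0" "4 * d * L \<le> 1/2"
  obtains c where "c 0 = u" "\<And>t. norm (c t - u) \<le> 4 * d * M"
    "\<And>t. -d < t \<Longrightarrow> t < d \<Longrightarrow> (c has_vector_derivative G (c t)) (at t)"
proof -
  \<comment> \<open>Clamping time makes the iterates bounded continuous functions on the whole line,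
    a complete space for the contraction principle.\<close>
  define cl where "cl t = max (-d) (min d t)" for t :: real
  have cl: "-d \<le> cl t" "cl t \<le> d" for t using d by (auto simp: cl_def)
  have contG: "continuous_on S G" for S
  proof (rule continuous_on_subset[OF _ subset_UNIV], rule lipschitz_on_continuous_on)
    show "\<bar>L\<bar>-lipschitz_on UNIV G"
    proof (rule lipschitz_onI)
      fix a b
      have "norm (G a - G b) \<le> L * norm (a - b)" by (rule L)
      also have "\<dots> \<le> \<bar>L\<bar> * norm (a - b)" by (rule mult_right_mono) auto
      finally show "dist (G a) (G b) \<le> \<bar>L\<bar> * dist a b" by (simp add: dist_norm)
    qed simp
  qed
  define J where "J \<phi> t = integral {-d..t} (\<lambda>s. G (\<phi> s))" for \<phi> t
  have contGc: "continuous_on S (\<lambda>s. G (\<phi> s))" if "continuous_on S \<phi>" for \<phi> S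
    using continuous_on_compose2[OF contG[of UNIV] that] by auto
  have normJ: "norm (J \<phi> (cl t)) \<le> M * (d - (-d))" if "continuous_on UNIV \<phi>" for \<phi> t
    unfolding J_def using M cl contGc[OF continuous_on_subset[OF that subset_UNIV]]
    by (intro integral_norm_bound_Icc) auto
  have normJ0: "norm (J \<phi> 0) \<le> M * (d - (-d))" if "continuous_on UNIV \<phi>" for \<phi>
    using normJ[OF that, of 0] d by (simp add: cl_def)
  \<comment> \<open>Subtracting \<open>J \<phi> 0\<close> moves the base point from
    \<open>-d\<close> to 0. Two integrals over length at most \<open>2 * d\<close> each account for
    the factor 4 in \<open>4 * d * M\<close> and \<open>4 * d * L\<close>.\<close>
  define T where "T \<phi> t = u + J \<phi> (cl t) - J \<phi> 0" for \<phi> t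
  have T_bound: "norm (T \<phi> t - u) \<le> 4 * d * M" if "continuous_on UNIV \<phi>" for \<phi> t
  proof -
    have "norm (T \<phi> t - u) \<le> norm (J \<phi> (cl t)) + norm (J \<phi> 0)" by (simp add: T_def norm_triangle_ineq4)
    then show ?thesis using normJ[OF that, of t] normJ0[OF that] by (simp add: algebra_simps)
  qed
  have T_bcont: "T \<phi> \<in> bcontfun" if "continuous_on UNIV \<phi>" for \<phi>
  proof -
    have "continuous_on {-d..d} (J \<phi>)"
      unfolding J_def using contGc that
      by (intro indefinite_integral_continuous_1 integrable_continuous_real) (auto intro: continuous_on_subset)
    moreover have "continuous_on UNIV cl" unfolding cl_def by (intro continuous_intros)
    ultimately have "continuous_on UNIV (\<lambda>t. J \<phi> (cl t))"
      by (rule continuous_on_compose2) (use cl in auto)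
    then have "continuous_on UNIV (T \<phi>)" unfolding T_def by (intro continuous_intros)
    moreover have "bounded (range (T \<phi>))"
      using T_bound[OF that] by (intro boundedI[of _ "norm u + 4 * d * M"])
        (auto intro: order_trans[OF norm_triangle_sub[of _ u]])
    ultimately show ?thesis by (simp add: bcontfun_def)
  qed
  define TT where "TT \<phi> = Bcontfun (T (apply_bcontfun \<phi>))" for \<phi> :: "real \<Rightarrow>\<^sub>C 'a"
  have TT: "apply_bcontfun (TT \<phi>) = T (apply_bcontfun \<phi>)" for \<phi>
    unfolding TT_def by (rule Bcontfun_inverse[OF T_bcont]) simp
  have "dist (TT \<phi>) (TT \<psi>) \<le> 1/2 * dist \<phi> \<psi>" for \<phi> \<psi>
  proof (rule dist_bound)
    fix t
    have J_diff: "norm (J \<phi> x - J \<psi> x) \<le> \<bar>L\<bar> * dist \<phi> \<psi> * (d - (-d))" if "-d \<le> x" "x \<le> d" for x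
    proof -
      have "J \<phi> x - J \<psi> x = integral {-d..x} (\<lambda>s. G (\<phi> s) - G (\<psi> s))"
        unfolding J_def by (subst integral_diff) (auto intro!: integrable_continuous_real contGc)
      moreover have "norm (\<dots>) \<le> \<bar>L\<bar> * dist \<phi> \<psi> * (d - (-d))"
      proof (rule integral_norm_bound_Icc)
        show "continuous_on {-d..d} (\<lambda>s. G (\<phi> s) - G (\<psi> s))"
          by (intro continuous_on_diff contGc) auto
        fix s
        have "norm (G (\<phi> s) - G (\<psi> s)) \<le> L * norm (\<phi> s - \<psi> s)" by (rule L)
        also have "\<dots> \<le> \<bar>L\<bar> * norm (\<phi> s - \<psi> s)" by (rule mult_right_mono) auto
        also have "\<dots> \<le> \<bar>L\<bar> * dist \<phi> \<psi>"
          using dist_bounded[of \<phi> s \<psi>] by (intro mult_left_mono) (auto simp: dist_norm)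
        finally show "norm (G (\<phi> s) - G (\<psi> s)) \<le> \<bar>L\<bar> * dist \<phi> \<psi>" .
      qed (use that in auto)
      ultimately show ?thesis by simp
    qed
    have "0 \<le> L * norm (a - b)" for a b :: 'a using L[of a b] norm_ge_zero order_trans by blast
    from this[of "SOME i. i \<in> Basis" 0] have "0 \<le> L"
      by (simp add: SOME_Basis)
    have "dist (TT \<phi> t) (TT \<psi> t) = norm ((J \<phi> (cl t) - J \<psi> (cl t)) - (J \<phi> 0 - J \<psi> 0))"
      unfolding TT T_def dist_norm by (simp add: algebra_simps)
    also have "\<dots> \<le> norm (J \<phi> (cl t) - J \<psi> (cl t)) + norm (J \<phi> 0 - J \<psi> 0)"
      by (rule norm_triangle_ineq4)
    also have "\<dots> \<le> 4 * d * L * dist \<phi> \<psi>"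
      using J_diff[OF cl, of t] J_diff[of 0] d \<open>0 \<le> L\<close> by (simp add: algebra_simps)
    also have "\<dots> \<le> 1/2 * dist \<phi> \<psi>" using d(2) by (intro mult_right_mono) auto
    finally show "dist (TT \<phi> t) (TT \<psi> t) \<le> 1/2 * dist \<phi> \<psi>" .
  qed
  then obtain \<phi> where fix_TT: "TT \<phi> = \<phi>"
    using banach_fix_type[of "1/2" TT] by auto
  then have c: "apply_bcontfun \<phi> t = T \<phi> t" for t using TT[of \<phi>] by simp
  show ?thesis
  proof (rule that[of "apply_bcontfun \<phi>"])
    show "apply_bcontfun \<phi> 0 = u" using c[of 0] d by (simp add: T_def cl_def)
    show "norm (apply_bcontfun \<phi> t - u) \<le> 4 * d * M" for t
      using T_bound[of "apply_bcontfun \<phi>" t] unfolding c[symmetric] by simp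
    fix t assume t: "-d < t" "t < d"
    have "(J \<phi> has_vector_derivative G (\<phi> t)) (at t within {-d..d})"
      unfolding J_def using t by (intro integral_has_vector_derivative contGc) auto
    then have "(J \<phi> has_vector_derivative G (\<phi> t)) (at t)"
      using at_within_interior[of t "{-d..d}"] t by (simp add: interior_atLeastAtMost_real)
    then have deriv: "((\<lambda>t. u + J \<phi> t - J \<phi> 0) has_vector_derivative G (\<phi> t)) (at t)"
      by (auto intro!: derivative_eq_intros)
    have "u + J \<phi> s - J \<phi> 0 = apply_bcontfun \<phi> s" if "s \<in> {-d<..<d}" for s
      using c[of s] that by (simp add: T_def cl_def)
    from has_vector_derivative_transform_within_open[OF deriv open_greaterThanLessThan _ this]
    show "(apply_bcontfun \<phi> has_vector_derivative G (apply_bcontfun \<phi> t)) (at t)"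
      using t by simp
  qed
qed

text \<open>Composing \<open>F\<close> with the nearest-point projection onto a ball makes it
  globally Lipschitz and bounded. The solution stays in the ball, where the projection is the
  identity, so it solves the original equation.\<close>

lemma ode_local_existence:
  fixes F :: "'a::euclidean_space \<Rightarrow> 'a"
  assumes D: "open D" "u \<in> D" and F: "Ck_on 1 D F"
  obtains d c where "d > 0" "c 0 = u" "\<And>t. -d < t \<Longrightarrow> t < d \<Longrightarrow> c t \<in> D"
    "\<And>t. -d < t \<Longrightarrow> t < d \<Longrightarrow> (c has_vector_derivative F (c t)) (at t)"
proof -
  obtain r where r: "r > 0" "cball u r \<subseteq> D" using D open_contains_cball by blast
  obtain L where L: "L \<ge> 0"
    "\<And>a b. a \<in> cball u r \<Longrightarrow> b \<in> cball u r \<Longrightarrow> norm (F a - F b) \<le> L * norm (a - b)"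
    using Ck_on_1_lipschitz_on_cball[OF F r(2)] by blast
  define P where "P = closest_point (cball u r)"
  have P: "P a \<in> cball u r" "norm (P a - P b) \<le> norm (a - b)" for a b
    using r closest_point_in_set[of "cball u r"] closest_point_lipschitz[of "cball u r" a b]
    by (auto simp: P_def dist_norm)
  define M where "M = norm (F u) + L * r"
  have "M \<ge> 0" using L r by (simp add: M_def)
  \<comment> \<open>The first entry gives the contraction \<open>4 * d * L \<le> 1/2\<close>, the
    second the confinement \<open>4 * d * M \<le> r\<close>; the summands 1 keep the denominators
    positive.\<close>
  define d where "d = min (1 / (8 * (L + 1))) (r / (4 * (M + 1)))"
  have "d > 0" using \<open>M \<ge> 0\<close> L r by (simp add: d_def)
  have dL: "4 * d * L \<le> 1/2"
  proof -
    have "4 * d * L \<le> 4 * d * (L + 1)" using \<open>d > 0\<close> by simp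
    also have "\<dots> \<le> 4 * (1 / (8 * (L + 1))) * (L + 1)"
      using L by (intro mult_right_mono mult_left_mono) (auto simp: d_def)
    also have "\<dots> = 1/2" using L by simp
    finally show ?thesis .
  qed
  have dM: "4 * d * M \<le> r"
  proof -
    have "4 * d * M \<le> 4 * d * (M + 1)" using \<open>d > 0\<close> by simp
    also have "\<dots> \<le> 4 * (r / (4 * (M + 1))) * (M + 1)"
      using \<open>M \<ge> 0\<close> by (intro mult_right_mono mult_left_mono) (auto simp: d_def)
    also have "\<dots> = r" using \<open>M \<ge> 0\<close> by (simp add: field_simps)
    finally show ?thesis .
  qed
  have G_lip: "norm (F (P a) - F (P b)) \<le> L * norm (a - b)" for a b
    using L(2)[OF P(1) P(1), of a b] mult_left_mono[OF P(2) L(1), of a b] by linarith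
  have G_bound: "norm (F (P a)) \<le> M" for a
  proof -
    have "norm (F (P a) - F u) \<le> L * norm (P a - u)" using r by (intro L(2) P) auto
    also have "\<dots> \<le> L * r" using P(1)[of a] L by (intro mult_left_mono) (auto simp: dist_norm norm_minus_commute)
    finally show ?thesis using norm_triangle_sub[of "F (P a)" "F u"] by (simp add: M_def)
  qed
  obtain c where c: "c 0 = u" "\<And>t. norm (c t - u) \<le> 4 * d * M"
    "\<And>t. -d < t \<Longrightarrow> t < d \<Longrightarrow> (c has_vector_derivative F (P (c t))) (at t)"
    using ode_existence_lipschitz[of "\<lambda>a. F (P a)" L M d u] G_lip G_bound \<open>d > 0\<close> dL by auto
  have inball: "c t \<in> cball u r" for t using c(2)[of t] dM by (simp add: dist_norm norm_minus_commute)
  then have "P (c t) = c t" for t unfolding P_def by (simp add: closest_point_self)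
  moreover have "c t \<in> D" for t using inball[of t] r(2) by blast
  ultimately show ?thesis using that[of d c] c \<open>d > 0\<close> by simp
qed

lemma smooth_on_ode_solution:
  fixes F :: "'a::euclidean_space \<Rightarrow> 'a"
  assumes I: "open I" and F: "smooth_on D F" and c: "c ` I \<subseteq> D"
    "\<And>t. t \<in> I \<Longrightarrow> (c has_vector_derivative F (c t)) (at t)"
  shows "smooth_on I c"
proof -
  have "Ck_on k I c" for k
  proof (induction k)
    case 0
    then show ?case
      using c(2) by (auto intro!: continuous_at_imp_continuous_on has_vector_derivative_continuous)
  next
    case (Suc k)
    have "Ck_on k I (\<lambda>t. F (c t))"
      using F by (intro Ck_on_compose[OF I _ Suc c(1)]) (simp add: smooth_on_def)
    then have "Ck_on k I (\<lambda>t. v *\<^sub>R F (c t))" for v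
      by (intro Ck_on_bilinear[OF bounded_bilinear_scaleR] Ck_on_const I)
    then show ?case
      using c(2) by (intro Ck_on_SucI[OF I, of c "\<lambda>t v. v *\<^sub>R F (c t)"]) (auto simp: has_vector_derivative_def)
  qed
  then show ?thesis by (simp add: smooth_on_def)
qed

section \<open>Charts and geodesics\<close>

lemma mink_inner: "mink v w = fst v \<bullet> fst w - snd v * snd w"
  by (simp add: mink_def inner_vec_def)

lemma bounded_bilinear_mink: "bounded_bilinear (mink :: 'n::finite minkowski \<Rightarrow> _)"
proof -
  have "bilinear (mink :: 'n::finite minkowski \<Rightarrow> _)"
    unfolding bilinear_def mink_inner
    by (auto intro!: linearI simp: inner_simps algebra_simps)
  then show ?thesis by (simp add: bilinear_conv_bounded_bilinear)
qed

interpretation mink: bounded_bilinear "mink :: 'n::finite minkowski \<Rightarrow> _"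
  by (rule bounded_bilinear_mink)

lemma mink_commute: "mink v w = mink w v"
  by (simp add: mink_inner inner_commute)

text \<open>Flipping the sign of the time coordinate in one argument turns the form into the
  Euclidean inner product.\<close>

lemma mink_eq_0_imp_eq_0:
  assumes "\<And>w. mink v w = 0"
  shows "v = 0"
proof -
  have "v \<bullet> v = mink v (fst v, - snd v)" by (cases v) (simp add: mink_inner)
  then show ?thesis using assms by simp
qed

section \<open>Parametrizations and change of coordinates\<close>

lemma local_paramD:
  assumes "local_param M x D \<psi>"
  shows "open D" "inj_on \<psi> D" "smooth_on D (x \<circ> \<psi>)" "continuous_on D \<psi>"
    "continuous_on (\<psi> ` D) (the_inv_into D \<psi>)" "\<psi> ` D \<subseteq> M"
    "\<And>u. u \<in> D \<Longrightarrow> inj (frechet_derivative (x \<circ> \<psi>) (at u))"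
  using assms openin_imp_subset[of "top_of_set M" "\<psi> ` D"]
  by (auto simp: local_param_def homeomorphism_def topspace_subtopology openin_subtopology)

lemma open_preimage_param:
  assumes "local_param M x D \<psi>" "open S" "continuous_on S \<alpha>" "\<alpha> ` S \<subseteq> M"
  shows "open {s \<in> S. \<alpha> s \<in> \<psi> ` D}"
proof -
  obtain W where W: "open W" "\<psi> ` D = M \<inter> W"
    using assms(1) by (auto simp: local_param_def openin_open)
  have "open (S \<inter> \<alpha> -` W)" by (rule continuous_open_preimage[OF assms(3,2) W(1)])
  moreover have "S \<inter> \<alpha> -` W = {s \<in> S. \<alpha> s \<in> \<psi> ` D}" using W(2) assms(4) by auto
  ultimately show ?thesis by simp
qed

text \<open>The coordinates of \<open>\<alpha>\<close> lift \<open>x \<circ> \<alpha>\<close>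
  through the immersion \<open>x \<circ> \<psi>\<close>. The domain is a general open set so that
  \<open>\<alpha>\<close> may be a curve or another parametrization.\<close>

lemma smooth_on_coordinates:
  fixes \<alpha> :: "'a::euclidean_space \<Rightarrow> 'm::topological_space"
  assumes lp: "local_param M x D \<psi>" and S: "open S" "continuous_on S \<alpha>" "\<alpha> ` S \<subseteq> M"
    and smooth: "smooth_on S (x \<circ> \<alpha>)"
  shows "smooth_on {s \<in> S. \<alpha> s \<in> \<psi> ` D} (the_inv_into D \<psi> \<circ> \<alpha>)"
proof (rule smooth_on_lift[where y = "x \<circ> \<psi>" and D = D and f = "x \<circ> \<alpha>"])
  note lpD = local_paramD[OF lp]
  let ?T = "{s \<in> S. \<alpha> s \<in> \<psi> ` D}"
  show "open ?T" by (rule open_preimage_param[OF lp S])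
  show "continuous_on ?T (the_inv_into D \<psi> \<circ> \<alpha>)"
    unfolding o_def by (rule continuous_on_compose2[OF lpD(5) continuous_on_subset[OF S(2)]]) auto
  show "(the_inv_into D \<psi> \<circ> \<alpha>) ` ?T \<subseteq> D"
    using the_inv_into_into[OF lpD(2)] by auto
  show "smooth_on ?T (x \<circ> \<alpha>)" using smooth by (rule smooth_on_subset) auto
  show "(x \<circ> \<psi>) ((the_inv_into D \<psi> \<circ> \<alpha>) s) = (x \<circ> \<alpha>) s" if "s \<in> ?T" for s
    using that by (simp add: f_the_inv_into_f[OF lpD(2)])
qed (use local_paramD[OF lp] in auto)

lemma has_derivative_coordinates:
  fixes \<alpha> :: "'a::euclidean_space \<Rightarrow> 'm::topological_space"
  assumes lp: "local_param M x D \<psi>" and S: "open S" "continuous_on S \<alpha>" "\<alpha> ` S \<subseteq> M"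
    and c: "smooth_on {s \<in> S. \<alpha> s \<in> \<psi> ` D} (the_inv_into D \<psi> \<circ> \<alpha>)"
    and f: "smooth_on D (f \<circ> \<psi>)" and s: "s \<in> S" "u \<in> D" "\<alpha> s = \<psi> u"
  shows "((f \<circ> \<alpha>) has_derivative
    (\<lambda>d. frechet_derivative (f \<circ> \<psi>) (at u) (frechet_derivative (the_inv_into D \<psi> \<circ> \<alpha>) (at s) d))) (at s)"
proof -
  note lpD = local_paramD[OF lp]
  let ?T = "{s \<in> S. \<alpha> s \<in> \<psi> ` D}"
  have sT: "s \<in> ?T" using s by auto
  have u: "(the_inv_into D \<psi> \<circ> \<alpha>) s = u" using s by (simp add: the_inv_into_f_f[OF lpD(2)])
  have "((\<lambda>s. (f \<circ> \<psi>) ((the_inv_into D \<psi> \<circ> \<alpha>) s)) has_derivative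
    (\<lambda>d. frechet_derivative (f \<circ> \<psi>) (at u) (frechet_derivative (the_inv_into D \<psi> \<circ> \<alpha>) (at s) d))) (at s)"
    using smooth_on_has_derivative[OF f s(2)]
    by (intro has_derivative_compose[OF smooth_on_has_derivative[OF c sT]]) (simp only: u)
  then show ?thesis
    by (rule has_derivative_transform_within_open[OF _ open_preimage_param[OF lp S] sT])
      (simp add: f_the_inv_into_f[OF lpD(2)])
qed

text \<open>The witness \<open>h\<close> is the derivative of the transition map, hence the same for
  \<open>x\<close> and every \<open>f\<close>; this makes tangent spaces and ambient derivatives
  independent of the chart.\<close>

lemma change_of_param:
  assumes lp: "local_param M x D \<psi>" and lp': "local_param M x D' \<psi>'"
    and u: "u \<in> D" "u' \<in> D'" "\<psi>' u' = \<psi> u"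
  obtains h where
    "\<And>v. frechet_derivative (x \<circ> \<psi>') (at u') v = frechet_derivative (x \<circ> \<psi>) (at u) (h v)"
    "\<And>(f :: _ \<Rightarrow> 'b::real_normed_vector) v. smooth_map M x f \<Longrightarrow>
      frechet_derivative (f \<circ> \<psi>') (at u') v = frechet_derivative (f \<circ> \<psi>) (at u) (h v)"
proof -
  note lpD' = local_paramD[OF lp']
  have c: "smooth_on {s \<in> D'. \<psi>' s \<in> \<psi> ` D} (the_inv_into D \<psi> \<circ> \<psi>')"
    by (rule smooth_on_coordinates[OF lp lpD'(1,4,6,3)])
  note hd = has_derivative_coordinates[OF lp lpD'(1,4,6) c _ u(2,1,3), THEN frechet_derivative_at, symmetric]
  show ?thesis
    by (rule that[of "frechet_derivative (the_inv_into D \<psi> \<circ> \<psi>') (at u')"])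
      (auto simp: hd local_paramD(3)[OF lp] lp smooth_map_def)
qed

lemma tangent_space_param:
  assumes lp: "local_param M x D \<psi>" and u: "u \<in> D"
  shows "tangent_space M x (\<psi> u) = range (frechet_derivative (x \<circ> \<psi>) (at u))"
proof
  show "range (frechet_derivative (x \<circ> \<psi>) (at u)) \<subseteq> tangent_space M x (\<psi> u)"
    using assms unfolding tangent_space_def by blast
  show "tangent_space M x (\<psi> u) \<subseteq> range (frechet_derivative (x \<circ> \<psi>) (at u))"
  proof
    fix w assume "w \<in> tangent_space M x (\<psi> u)"
    then obtain D' \<psi>' u' v where lp': "local_param M x D' \<psi>'" and u': "u' \<in> D'" "\<psi>' u' = \<psi> u"
      and w: "w = frechet_derivative (x \<circ> \<psi>') (at u') v"
      unfolding tangent_space_def by blast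
    show "w \<in> range (frechet_derivative (x \<circ> \<psi>) (at u))"
      unfolding w by (rule change_of_param[OF lp lp' u u']) blast
  qed
qed

text \<open>The definite description is justified by injectivity: representations of one tangent
  vector in two charts correspond under the transition derivative, which carries the derivative of
  \<open>V\<close> along.\<close>

lemma ambient_deriv_param:
  fixes V :: "'m::topological_space \<Rightarrow> 'n::finite minkowski"
  assumes lp: "local_param M x D \<psi>" and u: "u \<in> D" and V: "smooth_map M x V"
  shows "ambient_deriv M x V (\<psi> u) (frechet_derivative (x \<circ> \<psi>) (at u) v)
       = frechet_derivative (V \<circ> \<psi>) (at u) v"
  unfolding ambient_deriv_def
proof (rule the_equality)
  show "\<exists>D' \<psi>' u' v'. local_param M x D' \<psi>' \<and> u' \<in> D' \<and> \<psi>' u' = \<psi> u \<and>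
      frechet_derivative (x \<circ> \<psi>') (at u') v' = frechet_derivative (x \<circ> \<psi>) (at u) v \<and>
      frechet_derivative (V \<circ> \<psi>) (at u) v = frechet_derivative (V \<circ> \<psi>') (at u') v'"
    using lp u by blast
  fix w assume "\<exists>D' \<psi>' u' v'. local_param M x D' \<psi>' \<and> u' \<in> D' \<and> \<psi>' u' = \<psi> u \<and>
      frechet_derivative (x \<circ> \<psi>') (at u') v' = frechet_derivative (x \<circ> \<psi>) (at u) v \<and>
      w = frechet_derivative (V \<circ> \<psi>') (at u') v'"
  then obtain D' \<psi>' u' v' where *: "local_param M x D' \<psi>'" "u' \<in> D'" "\<psi>' u' = \<psi> u"
    and eq: "frechet_derivative (x \<circ> \<psi>') (at u') v' = frechet_derivative (x \<circ> \<psi>) (at u) v"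
      "w = frechet_derivative (V \<circ> \<psi>') (at u') v'"
    by blast
  obtain h where h: "\<And>v. frechet_derivative (x \<circ> \<psi>') (at u') v = frechet_derivative (x \<circ> \<psi>) (at u) (h v)"
    "\<And>(f :: 'm \<Rightarrow> 'n minkowski) v. smooth_map M x f \<Longrightarrow>
      frechet_derivative (f \<circ> \<psi>') (at u') v = frechet_derivative (f \<circ> \<psi>) (at u) (h v)"
    by (rule change_of_param[OF lp *(1) u *(2,3)]) blast
  have "h v' = v" using eq(1) h(1)[of v'] local_paramD(7)[OF lp u] by (auto dest: injD)
  then show "w = frechet_derivative (V \<circ> \<psi>) (at u) v" using eq(2) h(2)[OF V, of v'] by simp
qed

section \<open>The geodesic equation in ambient terms\<close>

lemma has_derivative_induced_metric:
  assumes lp: "local_param M x D \<psi>" and u: "u \<in> D"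
  shows "((\<lambda>q. induced_metric x \<psi> q v w) has_derivative
    (\<lambda>d. mink (frechet_derivative (x \<circ> \<psi>) (at u) v)
           (frechet_derivative (\<lambda>q. frechet_derivative (x \<circ> \<psi>) (at q) w) (at u) d)
       + mink (frechet_derivative (\<lambda>q. frechet_derivative (x \<circ> \<psi>) (at q) v) (at u) d)
           (frechet_derivative (x \<circ> \<psi>) (at u) w))) (at u)"
  unfolding induced_metric_def
  by (intro mink.FDERIV smooth_on_has_derivative[OF smooth_on_derivative[OF local_paramD(3)[OF lp]] u])

text \<open>Differentiating the metric produces two pairings of a first derivative with a mixed
  second derivative; by symmetry they cancel, which leaves the tangential part of the ambient second
  derivative.\<close>

lemma christoffel_eq_second_derivative:
  assumes lp: "local_param M x D \<psi>" and u: "u \<in> D"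
  shows "christoffel x \<psi> u v v z =
    mink (frechet_derivative (\<lambda>q. frechet_derivative (x \<circ> \<psi>) (at q) v) (at u) v)
      (frechet_derivative (x \<circ> \<psi>) (at u) z)"
  unfolding christoffel_def
    frechet_derivative_at[OF has_derivative_induced_metric[OF assms], symmetric]
    symmetric_second_derivative[OF local_paramD(1)[OF lp] u local_paramD(3)[OF lp], of v z]
  by (simp add: mink_commute)

section \<open>A tangent field and its integral curves in one chart\<close>

locale param_field =
  fixes M :: "'m::topological_space set" and x :: "'m \<Rightarrow> 'n::finite minkowski"
    and D :: "(real ^ 'n) set" and \<psi> :: "real ^ 'n \<Rightarrow> 'm" and X :: "'m \<Rightarrow> 'n minkowski"
  assumes lp: "local_param M x D \<psi>" and X: "tangent_field M x X"
begin

abbreviation dx :: "real ^ 'n \<Rightarrow> real ^ 'n \<Rightarrow> 'n minkowski" where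
  "dx u \<equiv> frechet_derivative (x \<circ> \<psi>) (at u)"

definition coords :: "real ^ 'n \<Rightarrow> real ^ 'n" where
  "coords u = inv (dx u) (X (\<psi> u))"

lemmas lpD = local_paramD[OF lp]

lemma linear_dx: "u \<in> D \<Longrightarrow> linear (dx u)"
  using has_derivative_linear[OF smooth_on_has_derivative[OF lpD(3)]] .

lemma smooth_X: "smooth_on D (X \<circ> \<psi>)"
  using X lp by (simp add: tangent_field_def smooth_map_def)

lemma dx_coords: "u \<in> D \<Longrightarrow> dx u (coords u) = X (\<psi> u)"
  using X lpD(6) tangent_space_param[OF lp]
  unfolding coords_def tangent_field_def by (intro f_inv_into_f) blast

lemma coordsI: "u \<in> D \<Longrightarrow> dx u v = X (\<psi> u) \<Longrightarrow> v = coords u"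
  using injD[OF lpD(7)] dx_coords by metis

lemma smooth_coords: "smooth_on D coords"
  unfolding smooth_on_def
proof
  fix k show "Ck_on k D coords"
  proof (rule Ck_on_solve[OF lpD(1)])
    show "Ck_on k D (\<lambda>u. dx u v)" for v
      using smooth_on_derivative[OF lpD(3)] by (simp add: smooth_on_def)
    show "Ck_on k D (X \<circ> \<psi>)" using smooth_X by (simp add: smooth_on_def)
  qed (use linear_dx lpD(7) dx_coords in auto)
qed

text \<open>Along an integral curve \<open>c' = coords c\<close>, so the left side is its geodesic
  equation. Both terms arise by differentiating \<open>dx q (coords q) = X (\<psi> q)\<close> in
  direction \<open>coords u\<close>.\<close>

lemma geodesic_expression:
  assumes u: "u \<in> D"
  shows "induced_metric x \<psi> u (frechet_derivative coords (at u) (coords u)) z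
      + christoffel x \<psi> u (coords u) (coords u) z
      = mink (frechet_derivative (X \<circ> \<psi>) (at u) (coords u)) (dx u z)"
proof -
  have "((\<lambda>q. dx q (coords q)) has_derivative
     (\<lambda>d. frechet_derivative (\<lambda>q. dx q (coords u)) (at u) d
          + dx u (frechet_derivative coords (at u) d))) (at u)"
    by (rule has_derivative_frechet_derivative_apply[OF lpD(1) u lpD(3)
          smooth_on_has_derivative[OF smooth_coords u]])
  then have "((X \<circ> \<psi>) has_derivative
     (\<lambda>d. frechet_derivative (\<lambda>q. dx q (coords u)) (at u) d
          + dx u (frechet_derivative coords (at u) d))) (at u)"
    by (rule has_derivative_transform_within_open[OF _ lpD(1) u]) (simp add: dx_coords)
  then show ?thesis
    unfolding christoffel_eq_second_derivative[OF lp u] induced_metric_def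
    by (simp add: frechet_derivative_at[symmetric] mink.add_left)
qed

text \<open>Injectivity of \<open>dx\<close> pulls the ambient equation back to
  \<open>c' = coords c\<close>. It holds on the open set of all times spent in the chart, so it can
  be differentiated again.\<close>

lemma integral_curve_coordinates:
  assumes ic: "integral_curve M x X I \<alpha>" and t: "t \<in> I" "\<alpha> t \<in> \<psi> ` D"
  defines "c \<equiv> the_inv_into D \<psi> \<circ> \<alpha>"
  shows "c t \<in> D" "vector_derivative c (at t) = coords (c t)"
    "vector_derivative (\<lambda>t. vector_derivative c (at t)) (at t) =
      frechet_derivative coords (at (c t)) (coords (c t))"
proof -
  let ?J = "{t \<in> I. \<alpha> t \<in> \<psi> ` D}"
  have I: "open I" "continuous_on I \<alpha>" "\<alpha> ` I \<subseteq> M" and c: "smooth_on ?J c"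
    and Xd: "\<And>t. t \<in> I \<Longrightarrow> ((x \<circ> \<alpha>) has_vector_derivative X (\<alpha> t)) (at t)"
    using ic lp by (auto simp: integral_curve_def smooth_curve_def c_def)
  have J: "open ?J" by (rule open_preimage_param[OF lp I])
  have cD: "c t \<in> D" "\<alpha> t = \<psi> (c t)" if "t \<in> ?J" for t
    using that the_inv_into_into[OF lpD(2)] f_the_inv_into_f[OF lpD(2)] by (auto simp: c_def)
  have cd: "(c has_vector_derivative coords (c t)) (at t)" if t: "t \<in> ?J" for t
  proof -
    note fd = smooth_on_has_derivative[OF c t]
    have "((x \<circ> \<alpha>) has_derivative (\<lambda>d. dx (c t) (frechet_derivative c (at t) d))) (at t)"
      using has_derivative_coordinates[OF lp I c[unfolded c_def] lpD(3) _ cD[OF t]] t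
      unfolding c_def[symmetric] by simp
    moreover have "((x \<circ> \<alpha>) has_derivative (\<lambda>d. d *\<^sub>R X (\<alpha> t))) (at t)"
      using Xd t by (auto simp: has_vector_derivative_def)
    ultimately have "(\<lambda>d. dx (c t) (frechet_derivative c (at t) d)) = (\<lambda>d. d *\<^sub>R X (\<alpha> t))"
      by (rule has_derivative_unique)
    then have "dx (c t) (frechet_derivative c (at t) 1) = 1 *\<^sub>R X (\<alpha> t)" by (rule fun_cong)
    then have "frechet_derivative c (at t) 1 = coords (c t)"
      using cD[OF t] by (intro coordsI) auto
    then have "frechet_derivative c (at t) d = d *\<^sub>R coords (c t)" for d
      using linear_scale[OF has_derivative_linear[OF fd], of d 1] by simp
    then have "frechet_derivative c (at t) = (\<lambda>d. d *\<^sub>R coords (c t))" by (rule ext)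
    then show ?thesis using fd by (simp add: has_vector_derivative_def)
  qed
  have tJ: "t \<in> ?J" using t by simp
  show "c t \<in> D" by (rule cD[OF tJ])
  show "vector_derivative c (at t) = coords (c t)" by (rule vector_derivative_at[OF cd[OF tJ]])
  have "((\<lambda>t. coords (c t)) has_derivative
      (\<lambda>d. frechet_derivative coords (at (c t)) (d *\<^sub>R coords (c t)))) (at t)"
    using cd[OF tJ] smooth_on_has_derivative[OF smooth_coords \<open>c t \<in> D\<close>]
    unfolding has_vector_derivative_def by (rule has_derivative_compose)
  then have "((\<lambda>t. coords (c t)) has_vector_derivative
      frechet_derivative coords (at (c t)) (coords (c t))) (at t)"
    using linear_scale[OF has_derivative_linear[OF smooth_on_has_derivative[OF smooth_coords \<open>c t \<in> D\<close>]]]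
    by (simp add: has_vector_derivative_def)
  from has_vector_derivative_transform_within_open[OF this J tJ]
  show "vector_derivative (\<lambda>t. vector_derivative c (at t)) (at t) =
      frechet_derivative coords (at (c t)) (coords (c t))"
    by (intro vector_derivative_at) (auto simp: vector_derivative_at[OF cd])
qed

text \<open>The system \<open>c' = coords c\<close> is solved in one chart. Smoothness in all other
  charts, demanded by \<open>smooth_curve\<close>, comes from
  \<open>smooth_on_coordinates\<close>.\<close>

lemma integral_curve_exists:
  assumes u: "u \<in> D"
  obtains I \<alpha> where "integral_curve M x X I \<alpha>" "0 \<in> I" "\<alpha> 0 = \<psi> u"
proof -
  have "Ck_on 1 D coords" using smooth_coords by (simp add: smooth_on_def)
  from ode_local_existence[OF lpD(1) u this]
  obtain d c where d: "d > 0" and c: "c 0 = u" "\<And>t. -d < t \<Longrightarrow> t < d \<Longrightarrow> c t \<in> D"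
    "\<And>t. -d < t \<Longrightarrow> t < d \<Longrightarrow> (c has_vector_derivative coords (c t)) (at t)"
    by blast
  define I where "I = {-d<..<d}"
  have I: "open I" "is_interval I" "0 \<in> I" using d by (auto simp: I_def is_interval_oo)
  have cD: "c ` I \<subseteq> D" using c(2) by (auto simp: I_def)
  have cd: "(c has_vector_derivative coords (c t)) (at t)" if "t \<in> I" for t using that c(3) by (simp add: I_def)
  have smooth_c: "smooth_on I c" by (rule smooth_on_ode_solution[OF I(1) smooth_coords cD cd])
  have cont: "continuous_on I (\<psi> \<circ> c)"
    using continuous_on_compose[OF smooth_on_imp_continuous_on[OF smooth_c]]
      continuous_on_subset[OF lpD(4) cD] by blast
  have sub: "(\<psi> \<circ> c) ` I \<subseteq> M" using cD lpD(6) by auto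
  have smooth: "smooth_on I (x \<circ> (\<psi> \<circ> c))"
    using smooth_on_compose[OF I(1) lpD(3) smooth_c cD] by (simp add: o_def)
  have "smooth_curve M x I (\<psi> \<circ> c)"
    unfolding smooth_curve_def
    using I sub cont smooth_on_coordinates[OF _ I(1) cont sub smooth] by blast
  moreover have "((x \<circ> (\<psi> \<circ> c)) has_vector_derivative X ((\<psi> \<circ> c) t)) (at t)" if "t \<in> I" for t
  proof -
    have ct: "c t \<in> D" using cD that by auto
    have "((\<lambda>t. (x \<circ> \<psi>) (c t)) has_derivative (\<lambda>d. dx (c t) (d *\<^sub>R coords (c t)))) (at t)"
      using cd[OF that] smooth_on_has_derivative[OF lpD(3) ct]
      unfolding has_vector_derivative_def by (rule has_derivative_compose)
    then show ?thesis
      using linear_scale[OF linear_dx[OF ct]] dx_coords[OF ct]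
      by (simp add: has_vector_derivative_def o_def)
  qed
  ultimately have "integral_curve M x X I (\<psi> \<circ> c)" by (simp add: integral_curve_def)
  then show ?thesis using that[of I "\<psi> \<circ> c"] I c(1) by simp
qed

end

text \<open>Along an integral curve the geodesic equation depends only on the point reached, and
  every chart point lies on such a curve; so curves can be eliminated in favour of a pointwise
  condition.\<close>

lemma integral_curves_geodesic_iff:
  assumes X: "tangent_field M x X"
  shows "(\<forall>I \<alpha>. integral_curve M x X I \<alpha> \<longrightarrow> geodesic M x I \<alpha>) \<longleftrightarrow>
    (\<forall>D \<psi> u v z. local_param M x D \<psi> \<and> u \<in> D \<and> frechet_derivative (x \<circ> \<psi>) (at u) v = X (\<psi> u) \<longrightarrow>
      mink (frechet_derivative (X \<circ> \<psi>) (at u) v) (frechet_derivative (x \<circ> \<psi>) (at u) z) = 0)"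
proof (intro iffI allI impI; (elim conjE)?)
  fix D \<psi> u v z
  assume geo: "\<forall>I \<alpha>. integral_curve M x X I \<alpha> \<longrightarrow> geodesic M x I \<alpha>"
    and lp: "local_param M x D \<psi>" and u: "u \<in> D"
    and v: "frechet_derivative (x \<circ> \<psi>) (at u) v = X (\<psi> u)"
  interpret param_field M x D \<psi> X by unfold_locales (fact lp X)+
  obtain I \<alpha> where \<alpha>: "integral_curve M x X I \<alpha>" "0 \<in> I" "\<alpha> 0 = \<psi> u"
    by (rule integral_curve_exists[OF u])
  define c where "c = the_inv_into D \<psi> \<circ> \<alpha>"
  have c0: "c 0 = u" using \<alpha>(3) the_inv_into_f_f[OF lpD(2) u] by (simp add: c_def)
  have "\<alpha> 0 \<in> \<psi> ` D" using \<alpha>(3) u by auto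
  note coord = integral_curve_coordinates[OF \<alpha>(1,2) this, folded c_def, unfolded c0]
  have "induced_metric x \<psi> (c 0) (vector_derivative (\<lambda>t. vector_derivative c (at t)) (at 0)) z
      + christoffel x \<psi> (c 0) (vector_derivative c (at 0)) (vector_derivative c (at 0)) z = 0"
    using geo[rule_format, OF \<alpha>(1)] lp \<alpha>(2) \<open>\<alpha> 0 \<in> \<psi> ` D\<close>
    unfolding geodesic_def c_def Let_def by blast
  then show "mink (frechet_derivative (X \<circ> \<psi>) (at u) v) (frechet_derivative (x \<circ> \<psi>) (at u) z) = 0"
    unfolding coord c0 geodesic_expression[OF u] using coordsI[OF u v] by simp
next
  fix I \<alpha>
  assume perp: "\<forall>D \<psi> u v z. local_param M x D \<psi> \<and> u \<in> D \<and> frechet_derivative (x \<circ> \<psi>) (at u) v = X (\<psi> u) \<longrightarrow>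
      mink (frechet_derivative (X \<circ> \<psi>) (at u) v) (frechet_derivative (x \<circ> \<psi>) (at u) z) = 0"
    and ic: "integral_curve M x X I \<alpha>"
  show "geodesic M x I \<alpha>"
    unfolding geodesic_def Let_def
  proof (intro conjI allI impI ballI)
    show "smooth_curve M x I \<alpha>" using ic by (simp add: integral_curve_def)
    fix D \<psi> t z assume lp: "local_param M x D \<psi>" and t: "t \<in> I" "\<alpha> t \<in> \<psi> ` D"
    interpret param_field M x D \<psi> X by unfold_locales (fact lp X)+
    note coord = integral_curve_coordinates[OF ic t]
    show "induced_metric x \<psi> ((the_inv_into D \<psi> \<circ> \<alpha>) t)
        (vector_derivative (\<lambda>t. vector_derivative (the_inv_into D \<psi> \<circ> \<alpha>) (at t)) (at t)) z
      + christoffel x \<psi> ((the_inv_into D \<psi> \<circ> \<alpha>) t)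
        (vector_derivative (the_inv_into D \<psi> \<circ> \<alpha>) (at t))
        (vector_derivative (the_inv_into D \<psi> \<circ> \<alpha>) (at t)) z = 0"
      unfolding coord(2,3) geodesic_expression[OF coord(1)]
      using perp lp coord(1) dx_coords[OF coord(1)] by blast
  qed
qed

section \<open>The canonical principal direction\<close>

lemma has_derivative_locally_const:
  assumes "(f has_derivative f') (at u)" "open T" "u \<in> T" "\<And>q. q \<in> T \<Longrightarrow> f q = a"
  shows "f' d = 0"
proof -
  have "((\<lambda>_. a) has_derivative f') (at u)"
    by (rule has_derivative_transform_within_open[OF assms(1-3)]) (use assms(4) in auto)
  from has_derivative_unique[OF this has_derivative_const] show ?thesis by simp
qed

text \<open>Differentiating \<open>f^3 = f\<close> gives \<open>(3 * f^2 - 1) * f' = 0\<close>, and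
  the first factor is -1 or 2. The uses are <N,N> and <e1,e1>.\<close>

lemma has_derivative_discrete_values:
  fixes f :: "'a::real_normed_vector \<Rightarrow> real"
  assumes f: "(f has_derivative f') (at u)" and T: "open T" "u \<in> T"
    and val: "\<And>q. q \<in> T \<Longrightarrow> f q \<in> {-1, 0, 1}"
  shows "f' d = 0"
proof -
  have "((\<lambda>q. f q ^ 3 - f q) has_derivative (\<lambda>d. 3 * f' d * f u ^ 2 - f' d)) (at u)"
    using f by (auto intro!: derivative_eq_intros)
  moreover have "f q ^ 3 - f q = 0" if "q \<in> T" for q using val[OF that] by auto
  ultimately have "3 * f' d * f u ^ 2 - f' d = 0"
    using has_derivative_locally_const[OF _ T] by blast
  then show ?thesis using val[OF T(2)] by auto
qed

locale oriented_chart = param_field M x D \<psi> e1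
  for M :: "'m::topological_space set" and x :: "'m \<Rightarrow> 'n::finite minkowski"
    and D :: "(real ^ 'n) set" and \<psi> :: "real ^ 'n \<Rightarrow> 'm" and e1 :: "'m \<Rightarrow> 'n minkowski" +
  fixes N :: "'m \<Rightarrow> 'n minkowski" and k :: "'n minkowski"
  assumes oriented: "oriented_hypersurface M x N"
    and character: "\<forall>p\<in>M. spacelike (tangential_part N k p) \<or> timelike (tangential_part N k p) \<or>
                 lightlike (tangential_part N k p)"
    and unit_field: "unit_field_along_tangential_part M x N k e1"
begin

definition n :: "real ^ 'n \<Rightarrow> 'n minkowski" where "n q = N (\<psi> q)"
definition U :: "real ^ 'n \<Rightarrow> 'n minkowski" where "U q = tangential_part N k (\<psi> q)"
definition e :: "real ^ 'n \<Rightarrow> 'n minkowski" where "e q = e1 (\<psi> q)"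
definition h :: "real ^ 'n \<Rightarrow> real" where "h q = mink k (n q)"
definition sg :: "real ^ 'n \<Rightarrow> real" where "sg q = mink (n q) (n q)"
text \<open>The Euclidean product is used because \<open>mink (U q) (U q)\<close> vanishes at
  light-like points; for \<open>e\<close> parallel to \<open>U\<close> it yields the same factor and
  shows that it is smooth.\<close>

definition c :: "real ^ 'n \<Rightarrow> real" where "c q = (e q \<bullet> U q) / (U q \<bullet> U q)"

abbreviation dn :: "real ^ 'n \<Rightarrow> real ^ 'n \<Rightarrow> 'n minkowski" where
  "dn u \<equiv> frechet_derivative n (at u)"
abbreviation dh :: "real ^ 'n \<Rightarrow> real ^ 'n \<Rightarrow> real" where
  "dh u z \<equiv> mink k (dn u z)"

lemma smooth_n: "smooth_on D n"
proof -
  have "n = N \<circ> \<psi>" by (simp add: n_def fun_eq_iff)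
  then show ?thesis
    using oriented lp by (simp add: oriented_hypersurface_def unit_normal_field_def smooth_map_def)
qed

lemmas has_derivative_n = smooth_on_has_derivative[OF smooth_n]

lemma psi_in_M: "q \<in> D \<Longrightarrow> \<psi> q \<in> M"
  using lpD(6) by auto

lemma sg_values: "q \<in> D \<Longrightarrow> sg q = 1 \<or> sg q = - 1"
  using oriented psi_in_M by (simp add: oriented_hypersurface_def unit_normal_field_def sg_def n_def)

lemma sg_square: "q \<in> D \<Longrightarrow> sg q * sg q = 1"
  using sg_values by fastforce

lemma mink_dx_n: "q \<in> D \<Longrightarrow> mink (dx q z) (n q) = 0"
  using oriented psi_in_M tangent_space_param[OF lp]
  by (simp add: oriented_hypersurface_def unit_normal_field_def n_def)

lemma has_derivative_h: "q \<in> D \<Longrightarrow> (h has_derivative dh q) (at q)"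
  unfolding h_def[abs_def] using has_derivative_n
  by (rule bounded_linear.has_derivative[OF mink.bounded_linear_right])

lemma mink_dn_n:
  assumes "q \<in> D"
  shows "mink (dn q d) (n q) = 0"
proof -
  have "(sg has_derivative (\<lambda>d. mink (n q) (dn q d) + mink (dn q d) (n q))) (at q)"
    unfolding sg_def[abs_def] by (intro mink.FDERIV has_derivative_n assms)
  moreover have "sg p \<in> {-1, 0, 1}" if "p \<in> D" for p using sg_values[OF that] by auto
  ultimately have "mink (n q) (dn q d) + mink (dn q d) (n q) = 0"
    using has_derivative_discrete_values[OF _ lpD(1) assms] by blast
  then show ?thesis by (simp add: mink_commute)
qed

lemma has_derivative_sg:
  assumes "q \<in> D"
  shows "(sg has_derivative (\<lambda>d. 0)) (at q)"
proof -
  have "(sg has_derivative (\<lambda>d. mink (n q) (dn q d) + mink (dn q d) (n q))) (at q)"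
    unfolding sg_def[abs_def] by (intro mink.FDERIV has_derivative_n assms)
  then show ?thesis using mink_dn_n[OF assms] by (simp add: mink_commute[of "n q"])
qed

text \<open>The normal is orthogonal to the image of \<open>dx q\<close> but not null, hence outside
  it; the image has codimension one, so the two span everything.\<close>

lemma decomposition:
  assumes q: "q \<in> D"
  obtains z a where "w = dx q z + a *\<^sub>R n q"
proof -
  let ?R = "range (dx q)"
  have sub: "subspace ?R" using linear_dx[OF q] by (simp add: linear_subspace_image)
  have "n q \<notin> ?R"
  proof
    assume "n q \<in> ?R"
    then have "sg q = 0" using mink_dx_n[OF q] unfolding sg_def by (metis imageE)
    then show False using sg_values[OF q] by auto
  qed
  moreover have "dim ?R = CARD('n)"
    using dim_image_eq[OF linear_dx[OF q], of UNIV] lpD(7)[OF q] by simp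
  ultimately have "dim (insert (n q) ?R) = DIM('n minkowski)"
    using sub by (simp add: dim_insert span_eq_iff[THEN iffD2])
  then have "span (insert (n q) ?R) = UNIV" by (simp only: dim_eq_full)
  then have "w \<in> span (insert (n q) ?R)" by simp
  then obtain a where "w - a *\<^sub>R n q \<in> ?R"
    using span_eq_iff[THEN iffD2, OF sub] by (auto simp: span_breakdown_eq)
  then obtain z where "w - a *\<^sub>R n q = dx q z" by auto
  then show ?thesis using that[of z a] by (simp add: algebra_simps)
qed

lemma tangent_eq_0:
  assumes "q \<in> D" "mink w (n q) = 0" "\<And>z. mink w (dx q z) = 0"
  shows "w = 0"
proof (rule mink_eq_0_imp_eq_0)
  fix w'
  obtain z a where "w' = dx q z + a *\<^sub>R n q" by (rule decomposition[OF assms(1)])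
  then show "mink w w' = 0" using assms by (simp add: mink.add_right mink.scaleR_right)
qed

lemma tangentE:
  assumes "q \<in> D" "mink w (n q) = 0"
  obtains z where "w = dx q z"
proof -
  obtain z a where w: "w = dx q z + a *\<^sub>R n q" by (rule decomposition[OF assms(1)])
  then have "a * sg q = 0"
    using assms mink_dx_n by (simp add: mink.add_left mink.scaleR_left sg_def)
  then have "a = 0" using sg_values[OF assms(1)] by auto
  then show ?thesis using that w by simp
qed

lemma U_eq: "U q = k - (sg q * h q) *\<^sub>R n q"
  by (simp add: U_def tangential_part_def sg_def h_def n_def)

lemma mink_U_n: "q \<in> D \<Longrightarrow> mink (U q) (n q) = 0"
  using sg_square[of q]
  by (simp add: U_eq mink.diff_left mink.scaleR_left h_def[symmetric] sg_def[symmetric] mult.assoc mult.commute)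

lemma mink_U_U:
  assumes "q \<in> D"
  shows "mink (U q) (U q) = mink k k - sg q * (h q)\<^sup>2"
proof -
  have "mink (U q) (U q) = mink (U q) k - sg q * h q * mink (U q) (n q)"
    by (subst (2) U_eq) (simp add: mink.diff_right mink.scaleR_right)
  also have "\<dots> = mink k (U q)" using mink_U_n[OF assms] by (simp add: mink_commute)
  also have "\<dots> = mink k k - sg q * (h q)\<^sup>2"
    by (simp add: U_eq mink.diff_right mink.scaleR_right h_def power2_eq_square)
  finally show ?thesis .
qed

lemma U_nonzero: "q \<in> D \<Longrightarrow> U q \<noteq> 0"
  using character psi_in_M by (auto simp: U_def spacelike_def timelike_def lightlike_def)

text \<open>Pairing \<open>U\<close> with itself fails at light-like points; a direction
  \<open>z\<close> of this kind supplies the denominator of \<open>k1\<close> instead.\<close>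

lemma U_transversal:
  assumes "q \<in> D"
  obtains z where "mink (U q) (dx q z) \<noteq> 0"
  using tangent_eq_0[OF assms mink_U_n[OF assms]] U_nonzero[OF assms] by blast

text \<open>Self-adjointness of the shape operator: differentiating the orthogonality of
  \<open>dx q v\<close> and \<open>n q\<close> expresses both sides by the symmetric second
  derivative of \<open>x\<close>.\<close>

lemma mink_dn_dx_symmetric:
  assumes q: "q \<in> D"
  shows "mink (dx q v) (dn q z) = mink (dx q z) (dn q v)"
proof -
  have "mink (dx q v) (dn q z) = - mink (frechet_derivative (\<lambda>q. dx q v) (at q) z) (n q)" for v z
  proof -
    have "((\<lambda>q. mink (dx q v) (n q)) has_derivative
       (\<lambda>z. mink (dx q v) (dn q z) + mink (frechet_derivative (\<lambda>q. dx q v) (at q) z) (n q))) (at q)"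
      by (intro mink.FDERIV has_derivative_n smooth_on_has_derivative[OF smooth_on_derivative[OF lpD(3)]] q)
    from has_derivative_locally_const[OF this lpD(1) q, of 0 z] show ?thesis
      using mink_dx_n by simp
  qed
  then show ?thesis using symmetric_second_derivative[OF lpD(1) q lpD(3), of v z] by simp
qed

text \<open>In other words, the gradient of \<open>h\<close> on \<open>M\<close> is \<open>- S(U)\<close>.\<close>

lemma mink_dn_U:
  assumes q: "q \<in> D" and a: "dx q a = U q"
  shows "mink (dn q a) (dx q z) = dh q z"
proof -
  have "dh q z = mink (U q) (dn q z)"
    using mink_dn_n[OF q, of z]
    by (simp add: U_eq mink.diff_left mink.scaleR_left mink_commute[of "n q"])
  then show ?thesis using mink_dn_dx_symmetric[OF q, of a z] a by (simp add: mink_commute)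
qed

lemma shape_operator_U:
  assumes q: "q \<in> D" and a: "dx q a = U q"
  shows "shape_operator M x N (\<psi> q) (U q) = - dn q a"
proof -
  have "n = N \<circ> \<psi>" by (simp add: n_def fun_eq_iff)
  moreover have "smooth_map M x N" using oriented by (simp add: oriented_hypersurface_def unit_normal_field_def)
  ultimately show ?thesis
    unfolding shape_operator_def a[symmetric] using ambient_deriv_param[OF lp q, of N a] by simp
qed

lemma dn_U_eq_scaleR_iff:
  assumes q: "q \<in> D" and a: "dx q a = U q"
  shows "dn q a = r *\<^sub>R U q \<longleftrightarrow> (\<forall>z. dh q z = r * mink (U q) (dx q z))"
proof
  assume "dn q a = r *\<^sub>R U q"
  then show "\<forall>z. dh q z = r * mink (U q) (dx q z)"
    using mink_dn_U[OF assms] by (metis mink.scaleR_left real_scaleR_def)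
next
  assume *: "\<forall>z. dh q z = r * mink (U q) (dx q z)"
  have "dn q a - r *\<^sub>R U q = 0"
    using * mink_dn_U[OF assms] mink_dn_n[OF q] mink_U_n[OF q]
    by (intro tangent_eq_0[OF q]) (simp_all add: mink.diff_left mink.scaleR_left)
  then show "dn q a = r *\<^sub>R U q" by simp
qed

text \<open>Proportionality of linear forms in \<open>z\<close> needs no preimage of
  \<open>U\<close> under \<open>dx q\<close>, and a single \<open>z\<close> with nonzero pairing
  determines \<open>r\<close>.\<close>

lemma shape_operator_U_eq_iff:
  assumes q: "q \<in> D"
  shows "shape_operator M x N (\<psi> q) (tangential_part N k (\<psi> q)) = r *\<^sub>R tangential_part N k (\<psi> q) \<longleftrightarrow>
    (\<forall>z. dh q z = - r * mink (U q) (dx q z))"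
proof -
  obtain a where a: "dx q a = U q" using tangentE[OF q mink_U_n[OF q]] by metis
  show ?thesis
    unfolding U_def[symmetric] shape_operator_U[OF q a] dn_U_eq_scaleR_iff[OF q a, symmetric]
    by (metis minus_minus scaleR_minus_left)
qed

section \<open>The factor \<open>c\<close> and the derivative of e1 along itself\<close>

lemma smooth_U: "smooth_on D U"
  unfolding U_eq[abs_def] sg_def h_def
  by (intro smooth_on_diff smooth_on_scaleR smooth_on_mult smooth_on_bilinear[OF bounded_bilinear_mink]
      smooth_on_const smooth_n lpD(1))

lemma smooth_e: "smooth_on D e"
proof -
  have "e = e1 \<circ> \<psi>" by (simp add: e_def fun_eq_iff)
  then show ?thesis using smooth_X by simp
qed

lemma e_eq: "q \<in> D \<Longrightarrow> e q = c q *\<^sub>R U q"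
  using unit_field psi_in_M[of q] U_nonzero[of q]
  by (auto simp: unit_field_along_tangential_part_def c_def e_def U_def)

lemma character_cases:
  assumes "q \<in> D"
  obtains "spacelike (U q)" "mink (e q) (e q) = 1"
    | "timelike (U q)" "mink (e q) (e q) = - 1"
    | "lightlike (U q)" "lightlike (e q)"
proof -
  have "spacelike (U q) \<or> timelike (U q) \<or> lightlike (U q)"
    using character psi_in_M[OF assms] by (simp add: U_def)
  moreover have "spacelike (U q) \<Longrightarrow> mink (e q) (e q) = 1" "timelike (U q) \<Longrightarrow> mink (e q) (e q) = - 1"
    "lightlike (U q) \<Longrightarrow> lightlike (e q)"
    using unit_field psi_in_M[OF assms] unfolding unit_field_along_tangential_part_def U_def e_def by blast+
  ultimately show ?thesis using that by blast
qed

lemma e_nonzero: "q \<in> D \<Longrightarrow> e q \<noteq> 0"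
  by (rule character_cases[of q]) (auto simp: lightlike_def mink.zero_left)

lemma c_nonzero: "q \<in> D \<Longrightarrow> c q \<noteq> 0"
  using e_eq[of q] e_nonzero[of q] by auto

lemma smooth_c: "smooth_on D c"
  unfolding c_def[abs_def]
  by (intro smooth_on_divide smooth_on_inner smooth_U smooth_e lpD(1)) (simp add: U_nonzero)

abbreviation dc :: "real ^ 'n \<Rightarrow> real ^ 'n \<Rightarrow> real" where
  "dc u \<equiv> frechet_derivative c (at u)"

lemma mink_de_dx:
  assumes q: "q \<in> D"
  shows "mink (frechet_derivative e (at q) d) (dx q z) =
    dc q d * mink (U q) (dx q z) - c q * (sg q * h q) * mink (dn q d) (dx q z)"
proof -
  have "(U has_derivative (\<lambda>d. - ((sg q * h q) *\<^sub>R dn q d + (sg q * dh q d) *\<^sub>R n q))) (at q)"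
    unfolding U_eq[abs_def]
    using has_derivative_n[OF q] has_derivative_sg[OF q] has_derivative_h[OF q]
    by (auto intro!: derivative_eq_intros)
  then have "((\<lambda>q. c q *\<^sub>R U q) has_derivative
     (\<lambda>d. c q *\<^sub>R (- ((sg q * h q) *\<^sub>R dn q d + (sg q * dh q d) *\<^sub>R n q)) + dc q d *\<^sub>R U q)) (at q)"
    by (intro has_derivative_scaleR smooth_on_has_derivative[OF smooth_c q])
  then have "(e has_derivative
     (\<lambda>d. c q *\<^sub>R (- ((sg q * h q) *\<^sub>R dn q d + (sg q * dh q d) *\<^sub>R n q)) + dc q d *\<^sub>R U q)) (at q)"
    by (rule has_derivative_transform_within_open[OF _ lpD(1) q]) (simp add: e_eq)
  then have "frechet_derivative e (at q) d =
      c q *\<^sub>R (- ((sg q * h q) *\<^sub>R dn q d + (sg q * dh q d) *\<^sub>R n q)) + dc q d *\<^sub>R U q"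
    by (simp add: frechet_derivative_at[symmetric])
  then show ?thesis
    using mink_dx_n[OF q, of z]
    by (simp add: mink.add_left mink.scaleR_left mink.diff_left mink.minus_left
        mink_commute[of "n q"])
qed

text \<open>This is the tangential acceleration of an integral curve, tested against
  \<open>dx q z\<close>. One factor \<open>c\<close> stems from \<open>e = c U\<close>, the other
  from differentiating along \<open>e\<close>; the gradient formula replaces the shape operator by
  \<open>dh\<close>.\<close>

lemma mink_de_coords:
  assumes q: "q \<in> D"
  shows "mink (frechet_derivative e (at q) (coords q)) (dx q z) =
    dc q (coords q) * mink (U q) (dx q z) - (c q)\<^sup>2 * (sg q * h q) * dh q z"
proof -
  obtain a where a: "dx q a = U q" using tangentE[OF q mink_U_n[OF q]] by metis
  have "dx q (c q *\<^sub>R a) = e q"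
    using linear_scale[OF linear_dx[OF q]] a e_eq[OF q] by simp
  then have "coords q = c q *\<^sub>R a" using coordsI[OF q] by (simp add: e_def)
  then have "dn q (coords q) = c q *\<^sub>R dn q a"
    using linear_scale[OF has_derivative_linear[OF has_derivative_n[OF q]]] by simp
  then show ?thesis
    unfolding mink_de_dx[OF q] using mink_dn_U[OF q a]
    by (simp add: mink.scaleR_left power2_eq_square)
qed

lemma mink_e_e_values:
  assumes "q \<in> D"
  shows "mink (e q) (e q) = 1 \<or> mink (e q) (e q) = - 1 \<or> lightlike (U q) \<and> mink (e q) (e q) = 0"
  by (rule character_cases[OF assms]) (auto simp: lightlike_def)

text \<open>Pairing \<open>k = \<phi> (e1 - N)\<close> with \<open>N\<close> gives
  \<open>sg * h = - \<phi>\<close>, hence \<open>U = \<phi> e1\<close>, so that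
  \<open>\<phi>\<close> is inverse to \<open>c\<close>. This replaces the missing normalization of
  <e1,e1>.\<close>

lemma lightlike_h:
  assumes q: "q \<in> D" and l: "lightlike (U q)"
  shows "h q \<noteq> 0" "c q * (sg q * h q) = - 1"
proof -
  obtain \<phi> where \<phi>: "k = \<phi> *\<^sub>R (e q - n q)"
    using unit_field l psi_in_M[OF q]
    unfolding unit_field_along_tangential_part_def e_def n_def U_def by blast
  have "mink (e q) (n q) = 0" using e_eq[OF q] mink_U_n[OF q] by (simp add: mink.scaleR_left)
  then have h: "h q = - \<phi> * sg q"
    unfolding h_def by (subst \<phi>) (simp add: mink.diff_left mink.scaleR_left sg_def)
  have sh: "sg q * h q = - \<phi>" using h sg_square[OF q] by (simp add: algebra_simps)
  then have "U q = \<phi> *\<^sub>R e q"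
    unfolding U_eq by (subst \<phi>) (simp add: algebra_simps)
  then have U: "U q = (\<phi> * c q) *\<^sub>R U q" using e_eq[OF q] by simp
  then have "(1 - \<phi> * c q) *\<^sub>R U q = 0" by (simp add: algebra_simps)
  then have "\<phi> * c q = 1" using U_nonzero[OF q] by simp
  then show "c q * (sg q * h q) = - 1" unfolding sh by (simp add: mult.commute)
  then show "h q \<noteq> 0" by auto
qed

lemma geodesic_if_principal:
  assumes q: "q \<in> D" and r: "\<And>z. dh q z = r * mink (U q) (dx q z)"
  shows "mink (frechet_derivative e (at q) (coords q)) (dx q z) = 0"
proof (cases "lightlike (U q)")
  case False
  \<comment> \<open>Local constancy of <e,e> makes the derivative of \<open>e\<close> along itself
    orthogonal to \<open>e\<close>. Its tangential part is a multiple of \<open>U\<close>, and <U,e>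
    is nonzero here, so the multiple is 0.\<close>
  have "((\<lambda>q. mink (e q) (e q)) has_derivative
     (\<lambda>d. mink (e q) (frechet_derivative e (at q) d) + mink (frechet_derivative e (at q) d) (e q))) (at q)"
    by (intro mink.FDERIV smooth_on_has_derivative[OF smooth_e q])
  moreover have "mink (e p) (e p) \<in> {-1, 0, 1}" if "p \<in> D" for p
    using mink_e_e_values[OF that] by auto
  ultimately have "mink (e q) (frechet_derivative e (at q) (coords q))
      + mink (frechet_derivative e (at q) (coords q)) (e q) = 0"
    using has_derivative_discrete_values[OF _ lpD(1) q] by blast
  then have "mink (frechet_derivative e (at q) (coords q)) (e q) = 0"
    by (simp add: mink_commute)
  then have "dc q (coords q) * mink (U q) (e q) - (c q)\<^sup>2 * (sg q * h q) * (r * mink (U q) (e q)) = 0"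
    using mink_de_coords[OF q, of "coords q"] unfolding r dx_coords[OF q] e_def[symmetric] by simp
  then have "(dc q (coords q) - (c q)\<^sup>2 * (sg q * h q) * r) * mink (U q) (e q) = 0"
    by (simp only: left_diff_distrib mult.assoc)
  moreover have "mink (U q) (e q) \<noteq> 0"
    using False c_nonzero[OF q] U_nonzero[OF q] e_eq[OF q] by (simp add: mink.scaleR_right lightlike_def)
  ultimately have "dc q (coords q) = (c q)\<^sup>2 * (sg q * h q) * r" by simp
  then show ?thesis unfolding mink_de_coords[OF q] r by simp
next
  case True
  \<comment> \<open>\<open>U\<close> stays light-like near \<open>q\<close>, hence \<open>h\<close> and \<open>c\<close> are locally constant.\<close>
  have "continuous_on D (\<lambda>q. mink (e q) (e q))"
    by (intro smooth_on_imp_continuous_on smooth_on_bilinear[OF bounded_bilinear_mink lpD(1)] smooth_e)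
  then have T_open: "open (D \<inter> (\<lambda>q. mink (e q) (e q)) -` {-1<..<1})"
    using lpD(1) by (intro continuous_open_preimage) auto
  \<comment> \<open>The interval isolates the value 0 among -1, 0 and 1, so \<open>U\<close> is
    light-like on all of \<open>T\<close>.\<close>
  define T where "T = D \<inter> (\<lambda>q. mink (e q) (e q)) -` {-1<..<1}"
  have "open T" using T_open by (simp add: T_def)
  have "mink (e q) (e q) = 0"
    using True e_eq[OF q] by (simp add: mink.scaleR_left mink.scaleR_right lightlike_def)
  then have qT: "q \<in> T" using q by (simp add: T_def)
  have TD: "p \<in> D" "lightlike (U p)" if "p \<in> T" for p
    using that mink_e_e_values[of p] by (auto simp: T_def)
  have hq: "h q \<noteq> 0" "sg q \<noteq> 0" using lightlike_h[OF q True] by auto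
  \<comment> \<open>With <U,U> = 0 on \<open>T\<close>, differentiating this identity at
    \<open>q\<close>, where \<open>h\<close> is nonzero, gives \<open>dh = 0\<close>. The constancy
    of \<open>c * (sg * h)\<close> then disposes of \<open>dc\<close> in the same way.\<close>
  have "sg p * (h p)\<^sup>2 = mink k k" if "p \<in> T" for p
    using TD[OF that] mink_U_U[of p] by (simp add: lightlike_def)
  moreover have "((\<lambda>p. sg p * (h p)\<^sup>2) has_derivative (\<lambda>d. sg q * (2 * h q * dh q d))) (at q)"
    using has_derivative_sg[OF q] has_derivative_h[OF q] by (auto intro!: derivative_eq_intros)
  ultimately have "sg q * (2 * h q * dh q d) = 0" for d
    using has_derivative_locally_const[OF _ \<open>open T\<close> qT] by blast
  then have dh0: "dh q d = 0" for d using hq by auto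
  have "((\<lambda>p. c p * (sg p * h p)) has_derivative (\<lambda>d. c q * (sg q * dh q d) + dc q d * (sg q * h q))) (at q)"
    using has_derivative_sg[OF q] has_derivative_h[OF q] smooth_on_has_derivative[OF smooth_c q]
    by (auto intro!: derivative_eq_intros)
  from has_derivative_locally_const[OF this \<open>open T\<close> qT, of "-1" "coords q"] lightlike_h(2) TD dh0
  have "dc q (coords q) * (sg q * h q) = 0" by simp
  then have "dc q (coords q) = 0" using hq by auto
  then show ?thesis unfolding mink_de_coords[OF q] dh0 by simp
qed

text \<open>The geodesic condition gives the identity only up to the factor \<open>h\<close>. A failure of the identity
  at \<open>q\<close> therefore forces \<open>h = 0\<close> near \<open>q\<close>, so that both sides vanish at \<open>q\<close>.\<close>

lemma principal_if_geodesic: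
  assumes geo: "\<And>q z. q \<in> D \<Longrightarrow> mink (frechet_derivative e (at q) (coords q)) (dx q z) = 0" and q: "q \<in> D"
  shows "dh q z * mink (U q) (dx q z') = dh q z' * mink (U q) (dx q z)"
proof (rule ccontr)
  assume neq: "\<not> ?thesis"
  \<comment> \<open>A two-by-two minor of the forms \<open>dh\<close> and pairing with
    \<open>U\<close>; being continuous, it stays nonzero near \<open>q\<close>.\<close>
  define B where "B q = dh q z * mink (U q) (dx q z') - dh q z' * mink (U q) (dx q z)" for q
  have "continuous_on D B"
    unfolding B_def
    by (intro smooth_on_imp_continuous_on smooth_on_diff smooth_on_mult smooth_on_bilinear[OF bounded_bilinear_mink]
        smooth_on_const smooth_on_derivative smooth_n lpD smooth_U)
  then have op: "open (D \<inter> B -` (- {0}))"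
    using lpD(1) by (intro continuous_open_preimage) auto
  have "h p = 0" if "p \<in> D \<inter> B -` (- {0})" for p
  proof -
    have p: "p \<in> D" "B p \<noteq> 0" using that by auto
    have *: "dc p (coords p) * mink (U p) (dx p z) = (c p)\<^sup>2 * (sg p * h p) * dh p z" for z
      using geo[OF p(1), of z] mink_de_coords[OF p(1), of z] by simp
    have "(c p)\<^sup>2 * (sg p * h p) * B p
        = ((c p)\<^sup>2 * (sg p * h p) * dh p z) * mink (U p) (dx p z')
        - ((c p)\<^sup>2 * (sg p * h p) * dh p z') * mink (U p) (dx p z)"
      by (simp add: B_def algebra_simps)
    \<comment> \<open>Both products equal \<open>dc p (coords p)\<close> times the same two pairings
      with \<open>U\<close>.\<close>
    also have "\<dots> = 0" unfolding *[symmetric] by simp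
    finally show ?thesis using p(2) c_nonzero[OF p(1)] sg_values[OF p(1)] by auto
  qed
  moreover have "q \<in> D \<inter> B -` (- {0})" using neq q by (simp add: B_def)
  ultimately have "dh q d = 0" for d
    using has_derivative_locally_const[OF has_derivative_h[OF q] op] by blast
  then show False using neq by simp
qed

end

theorem proposition2p7:
  fixes M :: "'m::{t2_space, second_countable_topology} set"
    and x :: "'m \<Rightarrow> 'n::finite minkowski"
    and N :: "'m \<Rightarrow> 'n minkowski"
    and k :: "'n minkowski"
    and e1 :: "'m \<Rightarrow> 'n minkowski"
  assumes "oriented_hypersurface M x N"
    and "\<forall>p\<in>M. spacelike (tangential_part N k p) \<or> timelike (tangential_part N k p) \<or>
                 lightlike (tangential_part N k p)"
    and "unit_field_along_tangential_part M x N k e1"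
  shows "CPD_hypersurface M x N k \<longleftrightarrow>
           (\<forall>I \<alpha>. integral_curve M x e1 I \<alpha> \<longrightarrow> geodesic M x I \<alpha>)"
proof -
  have e1: "tangent_field M x e1" using assms(3) by (simp add: unit_field_along_tangential_part_def)
  have chart: "oriented_chart M x D \<psi> e1 N k" if "local_param M x D \<psi>" for D \<psi>
    by unfold_locales (fact that e1 assms)+
  have e_comp: "e1 \<circ> \<psi> = oriented_chart.e \<psi> e1" if "local_param M x D \<psi>" for D \<psi>
    using oriented_chart.e_def[OF chart[OF that]] by (simp add: fun_eq_iff)
  have covered: "\<exists>D \<psi> u. local_param M x D \<psi> \<and> u \<in> D \<and> \<psi> u = p" if "p \<in> M" for p
    using assms(1) that by (fastforce simp: oriented_hypersurface_def immersed_hypersurface_def)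
  show ?thesis
    unfolding integral_curves_geodesic_iff[OF e1]
  proof (intro iffI allI impI; (elim conjE)?)
    fix D \<psi> u v z
    assume cpd: "CPD_hypersurface M x N k" and lp: "local_param M x D \<psi>" and u: "u \<in> D"
      and v: "frechet_derivative (x \<circ> \<psi>) (at u) v = e1 (\<psi> u)"
    interpret oriented_chart M x D \<psi> e1 N k by (rule chart[OF lp])
    obtain k1 where "shape_operator M x N (\<psi> u) (tangential_part N k (\<psi> u)) = k1 (\<psi> u) *\<^sub>R tangential_part N k (\<psi> u)"
      using cpd psi_in_M[OF u] unfolding CPD_hypersurface_def by blast
    then have "dh u z = - k1 (\<psi> u) * mink (U u) (dx u z)" for z
      unfolding shape_operator_U_eq_iff[OF u] by blast
    then show "mink (frechet_derivative (e1 \<circ> \<psi>) (at u) v) (frechet_derivative (x \<circ> \<psi>) (at u) z) = 0"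
      unfolding e_comp[OF lp] coordsI[OF u v] by (rule geodesic_if_principal[OF u])
  next
    assume perp: "\<forall>D \<psi> u v z. local_param M x D \<psi> \<and> u \<in> D \<and>
        frechet_derivative (x \<circ> \<psi>) (at u) v = e1 (\<psi> u) \<longrightarrow>
      mink (frechet_derivative (e1 \<circ> \<psi>) (at u) v) (frechet_derivative (x \<circ> \<psi>) (at u) z) = 0"
    \<comment> \<open>The description refers to no chart, so the local formulas found in different
      parametrizations agree automatically.\<close>
    define k1 where "k1 p =
      (THE r. shape_operator M x N p (tangential_part N k p) = r *\<^sub>R tangential_part N k p)" for p
    \<comment> \<open>By \<open>principal_if_geodesic\<close> the forms are proportional, so any
      direction \<open>z0\<close> with nonzero pairing gives the factor, and gives it
      uniquely.\<close>
    have quotient: "shape_operator M x N (\<psi> u) (tangential_part N k (\<psi> u)) = r *\<^sub>R tangential_part N k (\<psi> u)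
        \<longleftrightarrow> r = - mink k (frechet_derivative (oriented_chart.n \<psi> N) (at u) z0) /
            mink (tangential_part N k (\<psi> u)) (frechet_derivative (x \<circ> \<psi>) (at u) z0)"
      if lp: "local_param M x D \<psi>" and u: "u \<in> D"
        and z0: "mink (tangential_part N k (\<psi> u)) (frechet_derivative (x \<circ> \<psi>) (at u) z0) \<noteq> 0"
      for D \<psi> u r z0
    proof -
      interpret oriented_chart M x D \<psi> e1 N k by (rule chart[OF lp])
      have geo: "mink (frechet_derivative e (at q) (coords q)) (dx q z) = 0" if "q \<in> D" for q z
        using perp lp that dx_coords[OF that] e_comp[OF lp] by metis
      have z0': "mink (U u) (dx u z0) \<noteq> 0" using z0 by (simp add: U_def)
      have "(\<forall>z. dh u z = - r * mink (U u) (dx u z)) \<longleftrightarrow> r = - dh u z0 / mink (U u) (dx u z0)"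
      proof
        assume "\<forall>z. dh u z = - r * mink (U u) (dx u z)"
        then have "dh u z0 = - r * mink (U u) (dx u z0)" by blast
        then show "r = - dh u z0 / mink (U u) (dx u z0)" using z0' by simp
      next
        assume r: "r = - dh u z0 / mink (U u) (dx u z0)"
        show "\<forall>z. dh u z = - r * mink (U u) (dx u z)"
        proof
          fix z
          show "dh u z = - r * mink (U u) (dx u z)"
            using principal_if_geodesic[OF geo u, of z z0] z0' unfolding r by (simp add: field_simps)
        qed
      qed
      then show ?thesis unfolding shape_operator_U_eq_iff[OF u] by (simp add: U_def)
    qed
    have k1: "k1 (\<psi> u) = - mink k (frechet_derivative (oriented_chart.n \<psi> N) (at u) z0) /
            mink (tangential_part N k (\<psi> u)) (frechet_derivative (x \<circ> \<psi>) (at u) z0)"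
      if "local_param M x D \<psi>" "u \<in> D"
        "mink (tangential_part N k (\<psi> u)) (frechet_derivative (x \<circ> \<psi>) (at u) z0) \<noteq> 0"
      for D \<psi> u z0
      unfolding k1_def quotient[OF that] by simp
    show "CPD_hypersurface M x N k"
      unfolding CPD_hypersurface_def
    proof (intro exI[of _ k1] conjI ballI)
      show "smooth_map M x k1"
        unfolding smooth_map_def
      proof (intro allI impI smooth_on_local)
        fix D \<psi> u assume lp: "local_param M x D \<psi>" and u: "u \<in> D"
        interpret oriented_chart M x D \<psi> e1 N k by (rule chart[OF lp])
        obtain z0 where z0: "mink (U u) (dx u z0) \<noteq> 0" by (rule U_transversal[OF u])
        have smooth: "smooth_on D (\<lambda>q. mink (U q) (dx q z0))"
          by (intro smooth_on_bilinear[OF bounded_bilinear_mink] smooth_on_derivative lpD smooth_U)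
        \<comment> \<open>One direction \<open>z0\<close> serves for all points of \<open>T\<close>,
          which makes \<open>k1\<close> a quotient of smooth functions near
          \<open>u\<close>.\<close>
        define T where "T = D \<inter> (\<lambda>q. mink (U q) (dx q z0)) -` (- {0})"
        have T: "open T" "T \<subseteq> D" unfolding T_def
          using lpD(1) smooth_on_imp_continuous_on[OF smooth] by (auto intro!: continuous_open_preimage)
        have quotient_smooth: "smooth_on T (\<lambda>q. (-1 * dh q z0) / mink (U q) (dx q z0))"
        proof (intro smooth_on_divide smooth_on_mult smooth_on_const T(1))
          show "smooth_on T (\<lambda>q. mink (U q) (dx q z0))" using smooth T(2) by (rule smooth_on_subset)
          have "smooth_on D (\<lambda>q. dh q z0)"
            by (intro smooth_on_bilinear[OF bounded_bilinear_mink] smooth_on_derivative lpD smooth_on_const smooth_n)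
          then show "smooth_on T (\<lambda>q. dh q z0)" using T(2) by (rule smooth_on_subset)
        qed (auto simp: T_def)
        have "(k1 \<circ> \<psi>) q = (-1 * dh q z0) / mink (U q) (dx q z0)" if "q \<in> T" for q
          using k1[OF lp, of q z0] that by (simp add: T_def U_def)
        then have "smooth_on T (k1 \<circ> \<psi>) \<longleftrightarrow> smooth_on T (\<lambda>q. (-1 * dh q z0) / mink (U q) (dx q z0))"
          by (rule smooth_on_cong[OF T(1)])
        then have "smooth_on T (k1 \<circ> \<psi>)" using quotient_smooth by (rule iffD2)
        then show "\<exists>T. open T \<and> u \<in> T \<and> smooth_on T (k1 \<circ> \<psi>)"
          using T z0 u by (auto simp: T_def)
      qed
      fix p assume "p \<in> M"
      then obtain D \<psi> u where lp: "local_param M x D \<psi>" and u: "u \<in> D" and p: "p = \<psi> u"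
        using covered by blast
      interpret oriented_chart M x D \<psi> e1 N k by (rule chart[OF lp])
      obtain z0 where z0: "mink (U u) (dx u z0) \<noteq> 0" by (rule U_transversal[OF u])
      show "shape_operator M x N p (tangential_part N k p) = k1 p *\<^sub>R tangential_part N k p"
        unfolding p using quotient[OF lp u] k1[OF lp u] z0 unfolding U_def by blast
    qed
  qed
qed

end
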